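(* Let $d\ge 1$ and $k\ge 0$ be integers with $2k+2\ge d$, let $\omega(n)$ be a function with $\omega(n)\to\infty$, and let $p=\left(\frac{(2k+2)\log n+\omega(n)}{n}\right)^{1/\binom{2k+2}{d}}$. Then asymptotically almost surely the simplicial complex $\Delta_d(G_d(n,p))$ is $k$-connected.
   Context: $G_d(n,p)$ is the random $d$-dimensional simplicial complex on $[n]$ containing the full $(d-1)$-skeleton, each $(d+1)$-subset of $[n]$ being a $d$-face independently with probability $p$. For a simplicial complex $X$ on vertex set $V$, the $d$-clique complex $\Delta_d(X)$ is the simplicial complex on $V$ whose faces are all $F\subseteq V$ all of whose $(d+1)$-subsets are faces of $X$. A space is $k$-connected if for every $i\le k$ every continuous map $S^i\to X$ is homotopic to a constant map. "Asymptotically almost surely" means with probability tending to $1$ as $n\to\infty$. *)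

theory Defs
  imports "HOL-Homology.Homology" "HOL-Probability.Probability"
begin

text \<open>
  An abstract simplicial complex is represented by its set of faces, the empty face included.
\<close>

text \<open>
  The product topology is the usual topology of the realization only when the complex is
  finite, which is the only case used here.  Points are given by barycentric coordinates;
  the empty face contributes no point, since the coordinates must sum to 1.
\<close>
definition geometric_realization :: "'a set set \<Rightarrow> ('a \<Rightarrow> real) topology" where
  "geometric_realization K =
     subtopology (powertop_real UNIV)
       {x. (\<forall>v. 0 \<le> x v) \<and> {v. x v \<noteq> 0} \<in> K \<and> (\<Sum>v | x v \<noteq> 0. x v) = 1}"

definition k_connected :: "nat \<Rightarrow> 'a topology \<Rightarrow> bool" where
  "k_connected k X \<longleftrightarrow>
     (\<forall>i\<le>k. \<forall>f. continuous_map (nsphere i) X f \<longrightarrow>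
        (\<exists>c. homotopic_with (\<lambda>_. True) (nsphere i) X f (\<lambda>_. c)))"

definition clique_complex :: "nat \<Rightarrow> 'a set \<Rightarrow> 'a set set \<Rightarrow> 'a set set" where
  "clique_complex d V X = {F. F \<subseteq> V \<and> (\<forall>S. S \<subseteq> F \<and> card S = d + 1 \<longrightarrow> S \<in> X)}"

text \<open>
  The law of the random complex \<open>G_d(n,p)\<close>.  For \<open>p\<close> outside \<open>[0,1]\<close>, \<^const>\<open>bernoulli_pmf\<close>
  uses the nearest endpoint of that interval.
\<close>
definition random_complex :: "nat \<Rightarrow> nat \<Rightarrow> real \<Rightarrow> nat set set pmf" where
  "random_complex d n p =
     map_pmf
       (\<lambda>f. {F. F \<subseteq> {1..n} \<and> (card F \<le> d \<or> card F = d + 1 \<and> f F)})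
       (Pi_pmf {F. F \<subseteq> {1..n} \<and> card F = d + 1} False (\<lambda>_. bernoulli_pmf p))"

end

theory Submission
  imports Defs
begin

text \<open>
  By a union bound, with high probability every set \<open>S\<close> of \<open>2k+2\<close> vertices admits a vertex \<open>v\<close> outside
  \<open>S\<close> that spans a face with each \<open>d\<close>-subset of \<open>S\<close>; then \<open>v\<close> cones off the part of the clique complex \<open>K\<close>
  induced on \<open>S\<close>.  This implies \<open>k\<close>-connectedness.  A map from \<open>S\<^sup>i\<close>, \<open>i \<le> k\<close>, can be pushed into
  the \<open>k\<close>-skeleton, so it suffices that the \<open>k\<close>-skeleton is null homotopic in \<open>K\<close>.  Fix a vertex \<open>a\<close>.
  Going downwards through the faces \<open>\<tau>\<close> of the skeleton, one maps the order complex of the faces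
  containing \<open>\<tau>\<close> into the common link of \<open>\<tau>\<close> and \<open>a\<close>: the faces strictly above \<open>\<tau>\<close> are already
  mapped, their order complex has smaller dimension, and the common link satisfies the coning
  condition for that dimension, so the map extends over the cone by induction.  The resulting map is
  joined by straight lines both to the inclusion and to the constant map \<open>a\<close>.
\<close>

text \<open>The number 2k+2 comes from the induction. Passing to the common link of
  \<open>\<tau>\<close> and \<open>a\<close> spends \<open>card \<tau> + 1\<close> vertices of the
  coning budget and gains \<open>card \<tau>\<close> dimensions; the worst case is a single vertex,
  two vertices spent for one dimension. With budget 0 at the bottom this gives 2n for faces of at
  most n vertices, and n = k + 1. No subdivision of the domain is made: all that is used of a domain
  is that maps from closed subsets into simplex boundaries extend. This follows from counting
  coordinates, hence serves spheres and order complexes alike. A straight line needs a face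
  containing both supports. A point \<open>x\<close> and its image through the order complex need
  not have one, since the sets occurring there may be smaller than the support of \<open>x\<close>;
  so the inclusion is first moved to a map with smaller supports. In the union bound about n^(2k+2)
  vertex sets meet a failure chance of order exp(-(2k+2) log n - \<omega>(n)), which leaves a
  constant times exp(-\<omega>(n)). The root in p makes the chance that one vertex cones off a given
  set equal to the quotient under the root, capped at 1.\<close>

definition realization :: "'a set set \<Rightarrow> ('a \<Rightarrow> real) set" where
  "realization K = {x. (\<forall>v. 0 \<le> x v) \<and> {v. x v \<noteq> 0} \<in> K \<and> (\<Sum>v | x v \<noteq> 0. x v) = 1}"

text \<open>Passes to the type class topology on functions, where \<open>continuous_on\<close>,
  \<open>closed\<close> and \<open>compact\<close> are available.\<close>

lemma geometric_realization_eq: "geometric_realization K = top_of_set (realization K)"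
  by (simp add: geometric_realization_def realization_def euclidean_product_topology)

section \<open>Extending maps into simplex boundaries\<close>

text \<open>For finite nonempty \<open>\<sigma>\<close> the realization is a sphere of dimension
  \<open>card \<sigma> - 2\<close>, empty for a single vertex. So \<open>n < card \<sigma>\<close>
  below admits the spheres of dimension n - 1 and more.\<close>

definition simplex_boundary :: "'v set \<Rightarrow> 'v set set" where
  "simplex_boundary \<sigma> = {F. F \<subset> \<sigma>}"

text \<open>
  The extension characterisation of \<open>dim Z < n\<close>, with simplex boundaries in place of spheres.
  The first argument only fixes the vertex type.
\<close>
definition extends_to_boundary :: "'v itself \<Rightarrow> nat \<Rightarrow> 'z::topological_space set \<Rightarrow> bool" where
  "extends_to_boundary _ n Z \<longleftrightarrow>
     (\<forall>(\<sigma> :: 'v set) A f. finite \<sigma> \<and> n < card \<sigma> \<and> closedin (top_of_set Z) A \<and>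
        continuous_on A f \<and> f ` A \<subseteq> realization (simplex_boundary \<sigma>) \<longrightarrow>
        (\<exists>g. continuous_on Z g \<and> g ` Z \<subseteq> realization (simplex_boundary \<sigma>) \<and> (\<forall>x\<in>A. g x = f x)))"

lemma extends_to_boundaryD:
  fixes \<sigma> :: "'v set"
  assumes "extends_to_boundary TYPE('v) n Z" "finite \<sigma>" "n < card \<sigma>" "closedin (top_of_set Z) A"
    "continuous_on A f" "f ` A \<subseteq> realization (simplex_boundary \<sigma>)"
  shows "\<exists>g. continuous_on Z g \<and> g ` Z \<subseteq> realization (simplex_boundary \<sigma>) \<and> (\<forall>x\<in>A. g x = f x)"
  using assms(1)[unfolded extends_to_boundary_def, rule_format, of \<sigma> A f] assms(2-) by simp

text \<open>
  A grid of \<open>q ^ card J\<close> points of mesh \<open>e / q\<close> cannot be hit completely: the domain is covered by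
  \<open>O(q ^ k)\<close> cells whose images are too small to contain two grid points.
\<close>
lemma lipschitz_map_misses_point:
  fixes \<phi> :: "nat \<Rightarrow> 'x \<Rightarrow> real" and g :: "'j \<Rightarrow> 'x \<Rightarrow> real"
  assumes "finite J" and kJ: "k < card J" and e: "0 < e"
    and bd: "\<And>i x. i < k \<Longrightarrow> x \<in> X \<Longrightarrow> \<bar>\<phi> i x\<bar> \<le> B"
    and lip: "\<And>j x y. j \<in> J \<Longrightarrow> x \<in> X \<Longrightarrow> y \<in> X \<Longrightarrow>
                \<bar>g j x - g j y\<bar> \<le> C * (\<Sum>i<k. \<bar>\<phi> i x - \<phi> i y\<bar>)"
  obtains c where "\<And>j. j \<in> J \<Longrightarrow> \<bar>c j\<bar> < e" and "\<And>x. x \<in> X \<Longrightarrow> \<exists>j\<in>J. g j x \<noteq> c j"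
proof (rule ccontr)
  assume "\<not> thesis"
  with that have hit: "\<exists>x\<in>X. \<forall>j\<in>J. g j x = c j" if "\<And>j. j \<in> J \<Longrightarrow> \<bar>c j\<bar> < e" for c
    using that by blast
  \<comment> \<open>\<open>D\<close> is so large that a change of \<open>1 / (D * q)\<close> in
    every coordinate changes each \<open>g j\<close> by less than \<open>e / q\<close>, the spacing
    of the grid.\<close>
  obtain D :: nat where D: "\<bar>C\<bar> * real k / e < real D"
    using reals_Archimedean2 by blast
  then have D0: "0 < D"
    by (metis abs_ge_zero divide_nonneg_pos e less_le_trans linorder_not_less mult_nonneg_nonneg of_nat_0_le_iff of_nat_less_0_iff of_nat_le_0_iff not_gr_zero order_less_irrefl)
  obtain M :: nat where M: "\<bar>B\<bar> < real M" using reals_Archimedean2 by blast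
  define E where "E = 2 * M * D + 1"
  \<comment> \<open>There are at most \<open>(E * q) ^ k\<close> cells, and \<open>E ^ k < q\<close>
    makes this less than \<open>q ^ Suc k\<close>.\<close>
  define q where "q = E ^ k + 1"
  have q0: "q > 0" by (simp add: q_def)
  define c where "c = (\<lambda>(a::'j \<Rightarrow> nat) j. e * real (a j) / real q)"
  define G where "G = (\<Pi>\<^sub>E j\<in>J. {..<q})"
  have "\<exists>x\<in>X. \<forall>j\<in>J. g j x = c a j" if "a \<in> G" for a
  proof (rule hit)
    fix j assume "j \<in> J"
    then have "a j < q" using that by (auto simp: G_def PiE_iff)
    then have "e * real (a j) < e * real q" using e by simp
    then show "\<bar>c a j\<bar> < e" using e q0 by (simp add: c_def field_simps)
  qed
  then obtain x where x: "\<And>a. a \<in> G \<Longrightarrow> x a \<in> X" "\<And>a j. a \<in> G \<Longrightarrow> j \<in> J \<Longrightarrow> g j (x a) = c a j"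
    by metis
  define cell where "cell = (\<lambda>a. \<lambda>i\<in>{..<k}. \<lfloor>\<phi> i (x a) * real (D * q)\<rfloor>)"
  have "inj_on cell G"
  proof (rule inj_onI)
    fix a b assume ab: "a \<in> G" "b \<in> G" "cell a = cell b"
    have d: "\<bar>\<phi> i (x a) - \<phi> i (x b)\<bar> \<le> 1 / real (D * q)" if "i < k" for i
    proof -
      have "\<lfloor>\<phi> i (x a) * real (D * q)\<rfloor> = \<lfloor>\<phi> i (x b) * real (D * q)\<rfloor>"
        using fun_cong[OF ab(3), of i] that by (simp add: cell_def)
      then have "\<bar>\<phi> i (x a) * real (D * q) - \<phi> i (x b) * real (D * q)\<bar> \<le> 1" by linarith
      then have "\<bar>\<phi> i (x a) - \<phi> i (x b)\<bar> * real (D * q) \<le> 1"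
        by (metis abs_mult abs_of_nat left_diff_distrib)
      then show ?thesis using D0 q0 by (simp add: field_simps)
    qed
    have "a j = b j" if "j \<in> J" for j
    proof -
      have "\<bar>c a j - c b j\<bar> \<le> C * (\<Sum>i<k. \<bar>\<phi> i (x a) - \<phi> i (x b)\<bar>)"
        using lip[OF that, of "x a" "x b"] x ab that by metis
      also have "\<dots> \<le> \<bar>C\<bar> * (\<Sum>i<k. \<bar>\<phi> i (x a) - \<phi> i (x b)\<bar>)"
        by (intro mult_right_mono sum_nonneg) auto
      also have "\<dots> \<le> \<bar>C\<bar> * (\<Sum>i<k. 1 / real (D * q))"
        by (intro mult_left_mono sum_mono) (use d in auto)
      also have "\<dots> = (\<bar>C\<bar> * real k) / real D / real q" by simp
      also have "\<dots> < e / real q"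
        using D D0 e q0 by (intro divide_strict_right_mono) (auto simp: field_simps)
      finally have "\<bar>e / real q * (real (a j) - real (b j))\<bar> < e / real q"
        by (simp add: c_def algebra_simps)
      then have "e / real q * \<bar>real (a j) - real (b j)\<bar> < e / real q * 1"
        using e q0 by (simp add: abs_mult)
      then have "\<bar>real (a j) - real (b j)\<bar> < 1" using e q0 by (simp only: mult_less_cancel_left_pos divide_pos_pos of_nat_0_less_iff)
      then show "a j = b j" by linarith
    qed
    then show "a = b" using ab by (auto simp: G_def intro: PiE_ext)
  qed
  moreover have "cell ` G \<subseteq> (\<Pi>\<^sub>E i\<in>{..<k}. {- int (M * D * q) .. int (M * D * q)})"
  proof (intro image_subsetI)
    fix a assume a: "a \<in> G"
    have "- int (M * D * q) \<le> \<lfloor>\<phi> i (x a) * real (D * q)\<rfloor> \<and> \<lfloor>\<phi> i (x a) * real (D * q)\<rfloor> \<le> int (M * D * q)" if "i < k" for i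
    proof -
      have "\<bar>\<phi> i (x a)\<bar> * real (D * q) \<le> real M * real (D * q)"
        using bd[OF that x(1)[OF a]] M by (intro mult_right_mono) auto
      then have "\<bar>\<phi> i (x a) * real (D * q)\<bar> \<le> real_of_int (int (M * D * q))"
        by (simp add: abs_mult mult.assoc)
      then show ?thesis by linarith
    qed
    then show "cell a \<in> (\<Pi>\<^sub>E i\<in>{..<k}. {- int (M * D * q) .. int (M * D * q)})"
      by (auto simp: cell_def)
  qed
  ultimately have "card G \<le> card (\<Pi>\<^sub>E i\<in>{..<k}. {- int (M * D * q) .. int (M * D * q)})"
    by (intro card_inj_on_le) (auto intro: finite_PiE)
  also have "\<dots> = (2 * (M * D * q) + 1) ^ k"
  proof -
    have "card {- int m .. int m} = 2 * m + 1" for m :: nat by simp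
    then show ?thesis by (simp only: card_PiE finite_lessThan prod_constant card_lessThan)
  qed
  also have "\<dots> \<le> (E * q) ^ k"
    using q0 by (intro power_mono) (simp_all add: E_def algebra_simps)
  also have "\<dots> = E ^ k * q ^ k" by (simp add: power_mult_distrib)
  also have "\<dots> < q * q ^ k" using q0 by (simp add: q_def)
  also have "\<dots> \<le> q ^ card J" using kJ q0 power_increasing[of "Suc k" "card J" q] by simp
  also have "\<dots> = card G" using \<open>finite J\<close> by (simp add: G_def card_PiE)
  finally show False by simp
qed

text \<open>The defining sum runs over the support, which varies with the point; over a fixed finite
  set it is linear and continuous in \<open>x\<close>.\<close>

lemma realization_iff_sum:
  assumes "finite V" "\<Union>K \<subseteq> V"
  shows "x \<in> realization K \<longleftrightarrow> (\<forall>v. 0 \<le> x v) \<and> {v. x v \<noteq> 0} \<in> K \<and> (\<Sum>v\<in>V. x v) = 1"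
proof -
  have "(\<Sum>v | x v \<noteq> 0. x v) = (\<Sum>v\<in>V. x v)" if "{v. x v \<noteq> 0} \<in> K"
    using assms that by (intro sum.mono_neutral_left) auto
  then show ?thesis by (auto simp: realization_def)
qed

lemma realization_simplex_boundary_iff:
  assumes "finite \<sigma>"
  shows "x \<in> realization (simplex_boundary \<sigma>) \<longleftrightarrow>
    (\<forall>v. 0 \<le> x v) \<and> {v. x v \<noteq> 0} \<subset> \<sigma> \<and> (\<Sum>v\<in>\<sigma>. x v) = 1"
proof -
  have "\<Union>(simplex_boundary \<sigma>) \<subseteq> \<sigma>" by (auto simp: simplex_boundary_def)
  from realization_iff_sum[OF assms this] show ?thesis by (simp add: simplex_boundary_def)
qed

section \<open>Minimum, excess and the push to the boundary of a simplex\<close>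

lemma continuous_on_Min:
  fixes f :: "'i \<Rightarrow> 'z::topological_space \<Rightarrow> real"
  assumes "finite I" "I \<noteq> {}" "\<And>i. i \<in> I \<Longrightarrow> continuous_on Z (f i)"
  shows "continuous_on Z (\<lambda>z. Min ((\<lambda>i. f i z) ` I))"
  using assms by (induction I rule: finite_ne_induct) (auto intro!: continuous_intros)

lemma Min_attained:
  assumes "finite \<sigma>" "\<sigma> \<noteq> {}"
  shows "\<exists>u\<in>\<sigma>. Min (x ` \<sigma>) = x u"
proof -
  have "Min (x ` \<sigma>) \<in> x ` \<sigma>" using assms by (intro Min_in) auto
  then show ?thesis by (simp only: image_iff)
qed

text \<open>For finite nonempty \<open>\<sigma>\<close> it vanishes exactly on the vectors that are
  constant on \<open>\<sigma>\<close> and nonnegative elsewhere it measures the distance from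
  them.\<close>

definition excess :: "'v set \<Rightarrow> ('v \<Rightarrow> real) \<Rightarrow> real" where
  "excess \<sigma> x = (\<Sum>v\<in>\<sigma>. x v - Min (x ` \<sigma>))"

lemma excess_pos:
  assumes "finite \<sigma>" "v \<in> \<sigma>" "w \<in> \<sigma>" "x v \<noteq> x w"
  shows "excess \<sigma> x > 0"
proof -
  have le: "Min (x ` \<sigma>) \<le> x u" if "u \<in> \<sigma>" for u using assms that by simp
  obtain u where "u \<in> \<sigma>" "Min (x ` \<sigma>) < x u"
    using le[of v] le[of w] assms by (metis antisym_conv2)
  then show ?thesis unfolding excess_def
    using assms le by (intro sum_pos2[of _ u]) auto
qed

text \<open>Each summand loses at most \<open>2 * e\<close>: once from its coordinate and once from
  the minimum.\<close>

lemma excess_perturb: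
  assumes "finite \<sigma>" "\<sigma> \<noteq> {}" "\<And>v. v \<in> \<sigma> \<Longrightarrow> \<bar>x v - y v\<bar> \<le> e"
  shows "excess \<sigma> y - 2 * e * real (card \<sigma>) \<le> excess \<sigma> x"
proof -
  obtain u where u: "u \<in> \<sigma>" "Min (y ` \<sigma>) = y u"
    using Min_attained[of \<sigma> y] assms by blast
  have "Min (x ` \<sigma>) \<le> x u" using assms u by simp
  then have "Min (x ` \<sigma>) \<le> Min (y ` \<sigma>) + e" using assms(3)[OF u(1)] u by simp
  then have "(\<Sum>v\<in>\<sigma>. y v - Min (y ` \<sigma>) - 2 * e) \<le> excess \<sigma> x"
    unfolding excess_def using assms(3) by (intro sum_mono) (auto simp: abs_le_iff, smt (verit))
  then show ?thesis by (simp add: excess_def sum_subtractf algebra_simps)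
qed

text \<open>
  Subtracting the minimum and rescaling fixes the boundary and is defined on every nonconstant
  vector; so a map into the simplex can be pushed to the boundary once it avoids the constants.
\<close>
definition push_to_boundary :: "'v set \<Rightarrow> ('v \<Rightarrow> real) \<Rightarrow> 'v \<Rightarrow> real" where
  "push_to_boundary \<sigma> x v = (if v \<in> \<sigma> then (x v - Min (x ` \<sigma>)) / excess \<sigma> x else 0)"

lemma push_to_boundary_in:
  assumes "finite \<sigma>" "excess \<sigma> x > 0"
  shows "push_to_boundary \<sigma> x \<in> realization (simplex_boundary \<sigma>)"
proof -
  have ne: "\<sigma> \<noteq> {}" using assms by (auto simp: excess_def)
  obtain u where u: "u \<in> \<sigma>" "Min (x ` \<sigma>) = x u"
    using Min_attained[of \<sigma> x] assms ne by blast
  have "push_to_boundary \<sigma> x u = 0" using u by (simp add: push_to_boundary_def)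
  moreover have "push_to_boundary \<sigma> x v = 0" if "v \<notin> \<sigma>" for v
    using that by (simp add: push_to_boundary_def)
  ultimately have "{v. push_to_boundary \<sigma> x v \<noteq> 0} \<subset> \<sigma>"
    using u(1) by blast
  moreover have "0 \<le> push_to_boundary \<sigma> x v" for v
    using assms by (auto simp: push_to_boundary_def)
  moreover have "(\<Sum>v\<in>\<sigma>. push_to_boundary \<sigma> x v) = 1"
    using assms by (simp add: push_to_boundary_def flip: sum_divide_distrib) (simp add: excess_def)
  ultimately show ?thesis using assms(1)
    by (simp add: realization_simplex_boundary_iff)
qed

text \<open>A boundary point has a zero coordinate on \<open>\<sigma>\<close>, so nothing is
  subtracted and the total is already 1.\<close>

lemma boundary_excess:
  assumes "finite \<sigma>" "x \<in> realization (simplex_boundary \<sigma>)"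
  shows "Min (x ` \<sigma>) = 0" "excess \<sigma> x = 1" "push_to_boundary \<sigma> x = x"
proof -
  have x: "\<forall>v. 0 \<le> x v" "{v. x v \<noteq> 0} \<subset> \<sigma>" "(\<Sum>v\<in>\<sigma>. x v) = 1"
    using assms by (simp_all add: realization_simplex_boundary_iff)
  then obtain u where "u \<in> \<sigma>" "x u = 0" by auto
  then show m: "Min (x ` \<sigma>) = 0"
    using assms(1) x by (intro Min_eqI) auto
  then show e: "excess \<sigma> x = 1" using x by (simp add: excess_def)
  show "push_to_boundary \<sigma> x = x"
    using x m e by (auto simp: push_to_boundary_def fun_eq_iff)
qed

lemma continuous_on_push_to_boundary:
  assumes "finite \<sigma>" "\<sigma> \<noteq> {}" "continuous_on Z H" "\<And>z. z \<in> Z \<Longrightarrow> excess \<sigma> (H z) > 0"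
  shows "continuous_on Z (\<lambda>z. push_to_boundary \<sigma> (H z))"
proof (rule continuous_on_coordinatewise_then_product)
  fix v
  have c: "continuous_on Z (\<lambda>z. H z w)" for w
    using assms(3) by (rule continuous_on_product_then_coordinatewise)
  have m: "continuous_on Z (\<lambda>z. Min (H z ` \<sigma>))"
    using continuous_on_Min[OF assms(1,2), of Z "\<lambda>i z. H z i"] c by simp
  have "continuous_on Z (\<lambda>z. excess \<sigma> (H z))"
    unfolding excess_def by (intro continuous_intros c m)
  then show "continuous_on Z (\<lambda>z. push_to_boundary \<sigma> (H z) v)"
    using assms(4) unfolding push_to_boundary_def
    by (cases "v \<in> \<sigma>") (auto intro!: continuous_intros c m simp: less_imp_neq[symmetric] dest: less_imp_neq, (metis less_irrefl)?)
qed

lemma realization_le_1: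
  assumes "finite V" "\<Union>K \<subseteq> V" "x \<in> realization K"
  shows "\<bar>x v\<bar> \<le> 1"
proof -
  have x: "\<forall>v. 0 \<le> x v" "{v. x v \<noteq> 0} \<in> K" "(\<Sum>v\<in>V. x v) = 1"
    using realization_iff_sum[OF assms(1,2), of x] assms(3) by blast+
  show ?thesis
  proof (cases "v \<in> V")
    case True
    then have "x v \<le> (\<Sum>v\<in>V. x v)" using x assms by (intro member_le_sum) auto
    then show ?thesis using x by simp
  next
    case False
    then have "x v = 0" using x(2) assms(2) by blast
    then show ?thesis by simp
  qed
qed

text \<open>
  A Tietze extension \<open>F\<close> is interpolated with a nowhere constant Lipschitz approximation \<open>G\<close>;
  the weight \<open>u\<close> uses \<open>F\<close> near \<open>A\<close> and \<open>G\<close> wherever \<open>F\<close> comes close to a constant vector.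
\<close>
lemma compact_cube_extends_to_boundary:
  fixes S :: "(nat \<Rightarrow> real) set"
  assumes "compact S" and van: "\<And>x i. x \<in> S \<Longrightarrow> k \<le> i \<Longrightarrow> x i = 0"
  shows "extends_to_boundary TYPE('v) (Suc k) S"
  unfolding extends_to_boundary_def
proof (intro allI impI, elim conjE)
  fix \<sigma> :: "'v set" and A f
  assume fin: "finite \<sigma>" and card: "Suc k < card \<sigma>" and A: "closedin (top_of_set S) A"
    and f: "continuous_on A f" "f ` A \<subseteq> realization (simplex_boundary \<sigma>)"
  have ne: "\<sigma> \<noteq> {}" using card by auto
  then obtain v0 where v0: "v0 \<in> \<sigma>" by blast
  \<comment> \<open>The interpolation below moves \<open>F\<close> by at most \<open>\<eta>\<close>,
    which lowers the excess by at most \<open>2 * \<eta> * card \<sigma> = 1 / 4\<close>; it does so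
    only partially where the excess of \<open>F\<close> exceeds 1 / 2, so no constant vector is
    reached there.\<close>
  define \<eta> where "\<eta> = 1 / (8 * real (card \<sigma>))"
  have \<eta>: "\<eta> > 0" using card by (simp add: \<eta>_def)
  \<comment> \<open>Lipschitz functions in the first \<open>k\<close> coordinates form a ring, since
    compactness bounds both factors of a product, and they separate points because all other
    coordinates vanish on \<open>S\<close>. Stone-Weierstrass then makes them dense.\<close>
  define R where "R = {g :: (nat \<Rightarrow> real) \<Rightarrow> real. continuous_on S g \<and>
     (\<exists>C. \<forall>x\<in>S. \<forall>y\<in>S. \<bar>g x - g y\<bar> \<le> C * (\<Sum>i<k. \<bar>x i - y i\<bar>))}"
  have bounded: "\<exists>B. \<forall>x\<in>S. \<bar>g x\<bar> \<le> B" if "continuous_on S g" for g :: "(nat \<Rightarrow> real) \<Rightarrow> real"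
    using compact_imp_bounded[OF compact_continuous_image[OF that \<open>compact S\<close>]]
    by (auto simp: bounded_iff)
  have coord: "continuous_on S (\<lambda>x. x i)" for i
    by (rule continuous_on_subset[OF continuous_on_product_coordinates]) auto
  interpret R: function_ring_on R S
  proof
    show "compact S" by fact
  next
    show "continuous_on S g" if "g \<in> R" for g using that by (simp add: R_def)
  next
    fix g h assume gh: "g \<in> R" "h \<in> R"
    obtain C where C: "\<And>x y. x \<in> S \<Longrightarrow> y \<in> S \<Longrightarrow> \<bar>g x - g y\<bar> \<le> C * (\<Sum>i<k. \<bar>x i - y i\<bar>)"
      using gh(1) unfolding R_def by blast
    obtain D where D: "\<And>x y. x \<in> S \<Longrightarrow> y \<in> S \<Longrightarrow> \<bar>h x - h y\<bar> \<le> D * (\<Sum>i<k. \<bar>x i - y i\<bar>)"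
      using gh(2) unfolding R_def by blast
    have "\<bar>(g x + h x) - (g y + h y)\<bar> \<le> (C + D) * (\<Sum>i<k. \<bar>x i - y i\<bar>)" if "x \<in> S" "y \<in> S" for x y
      using C[OF that] D[OF that] by (simp add: distrib_right)
    then show "(\<lambda>x. g x + h x) \<in> R" using gh by (auto simp: R_def intro!: continuous_intros)
    obtain B where B: "\<And>x. x \<in> S \<Longrightarrow> \<bar>g x\<bar> \<le> B" using bounded[of g] gh by (auto simp: R_def)
    obtain B' where B': "\<And>x. x \<in> S \<Longrightarrow> \<bar>h x\<bar> \<le> B'" using bounded[of h] gh by (auto simp: R_def)
    have "\<bar>g x * h x - g y * h y\<bar> \<le> (B * D + B' * C) * (\<Sum>i<k. \<bar>x i - y i\<bar>)" if xy: "x \<in> S" "y \<in> S" for x y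
    proof -
      have "g x * h x - g y * h y = g x * (h x - h y) + h y * (g x - g y)" by (simp add: algebra_simps)
      then have "\<bar>g x * h x - g y * h y\<bar> \<le> \<bar>g x\<bar> * \<bar>h x - h y\<bar> + \<bar>h y\<bar> * \<bar>g x - g y\<bar>"
        by (metis abs_mult abs_triangle_ineq)
      also have "\<dots> \<le> B * (D * (\<Sum>i<k. \<bar>x i - y i\<bar>)) + B' * (C * (\<Sum>i<k. \<bar>x i - y i\<bar>))"
        using B[OF xy(1)] B'[OF xy(2)] C[OF xy] D[OF xy]
        by (intro add_mono mult_mono) auto
      finally show ?thesis by (simp add: algebra_simps)
    qed
    then show "(\<lambda>x. g x * h x) \<in> R" using gh by (auto simp: R_def intro!: continuous_intros)
  next
    show "(\<lambda>_. c) \<in> R" for c by (auto simp: R_def intro!: exI[of _ 0])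
  next
    fix x y assume xy: "x \<in> S" "y \<in> S" "x \<noteq> y"
    then obtain i where i: "x i \<noteq> y i" by blast
    then have "i < k" using van[OF xy(1)] van[OF xy(2)] by (metis not_le)
    then have "\<bar>a i - b i\<bar> \<le> 1 * (\<Sum>i<k. \<bar>a i - b i\<bar>)" for a b :: "nat \<Rightarrow> real"
      using member_le_sum[of i "{..<k}" "\<lambda>i. \<bar>a i - b i\<bar>"] by simp
    then have "(\<lambda>x. x i) \<in> R"
      unfolding R_def mem_Collect_eq using coord[of i] by (intro conjI exI[of _ 1] ballI)
    then show "\<exists>f\<in>R. f x \<noteq> f y" by (rule bexI[rotated]) (rule i)
  qed
  have fin01: "\<bar>f x v\<bar> \<le> 1" if "x \<in> A" for x v
    by (rule realization_le_1[OF fin, of "simplex_boundary \<sigma>"]) (use f(2) that in \<open>auto simp: simplex_boundary_def\<close>)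
  have "\<exists>g. continuous_on S g \<and> (\<forall>x\<in>A. g x = f x v)" for v
    using Tietze[of A "\<lambda>x. f x v" S 1] A fin01 continuous_on_product_then_coordinatewise[OF f(1)]
    by (metis real_norm_def zero_le_one)
  then obtain F where F: "\<And>v. continuous_on S (F v)" "\<And>v x. x \<in> A \<Longrightarrow> F v x = f x v"
    by metis
  have "\<exists>g\<in>R. \<forall>x\<in>S. \<bar>F v x - g x\<bar> < \<eta> / 2" for v
    using R.Stone_Weierstrass_basic[OF F(1), of "\<eta> / 2" v] \<eta> by simp
  then obtain g where g: "\<And>v. g v \<in> R" "\<And>v x. x \<in> S \<Longrightarrow> \<bar>F v x - g v x\<bar> < \<eta> / 2"
    by metis
  have "\<forall>v. \<exists>C. \<forall>x\<in>S. \<forall>y\<in>S. \<bar>g v x - g v y\<bar> \<le> C * (\<Sum>i<k. \<bar>x i - y i\<bar>)"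
    using g(1) by (auto simp: R_def)
  then obtain C where C: "\<And>v x y. x \<in> S \<Longrightarrow> y \<in> S \<Longrightarrow> \<bar>g v x - g v y\<bar> \<le> C v * (\<Sum>i<k. \<bar>x i - y i\<bar>)"
    by metis
  have "\<forall>i. \<exists>B. \<forall>x\<in>S. \<bar>x i\<bar> \<le> B"
    using bounded[OF coord] by simp
  then obtain B where B: "\<And>i x. x \<in> S \<Longrightarrow> \<bar>x i\<bar> \<le> B i" by metis
  \<comment> \<open>Being constant on \<open>\<sigma>\<close> means that all differences to the
    value at \<open>v0\<close> vanish. These are \<open>card \<sigma> - 1 > k\<close> Lipschitz
    functions, so some small vector \<open>c\<close> is missed, and shifting by it removes every
    constant value.\<close>
  obtain c where c: "\<And>v. v \<in> \<sigma> - {v0} \<Longrightarrow> \<bar>c v\<bar> < \<eta> / 2"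
     "\<And>x. x \<in> S \<Longrightarrow> \<exists>v\<in>\<sigma> - {v0}. g v x - g v0 x \<noteq> c v"
  proof (rule lipschitz_map_misses_point[of "\<sigma> - {v0}" k "\<eta> / 2" S "\<lambda>i x. x i" "\<Sum>i<k. \<bar>B i\<bar>"
        "\<lambda>v x. g v x - g v0 x" "(\<Sum>v\<in>\<sigma>. \<bar>C v\<bar>) + \<bar>C v0\<bar>"])
    show "\<bar>x i\<bar> \<le> (\<Sum>i<k. \<bar>B i\<bar>)" if "i < k" "x \<in> S" for i x
    proof -
      have "\<bar>B i\<bar> \<le> (\<Sum>i<k. \<bar>B i\<bar>)"
        by (rule member_le_sum) (use that in auto)
      then show ?thesis using B[OF that(2), of i] by linarith
    qed
    show "\<bar>g v x - g v0 x - (g v y - g v0 y)\<bar> \<le> ((\<Sum>v\<in>\<sigma>. \<bar>C v\<bar>) + \<bar>C v0\<bar>) * (\<Sum>i<k. \<bar>x i - y i\<bar>)"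
      if v: "v \<in> \<sigma> - {v0}" and xy: "x \<in> S" "y \<in> S" for v x y
    proof -
      have s: "0 \<le> (\<Sum>i<k. \<bar>x i - y i\<bar>)" by (simp add: sum_nonneg)
      have "\<bar>C v\<bar> \<le> (\<Sum>v\<in>\<sigma>. \<bar>C v\<bar>)"
        by (rule member_le_sum) (use v fin in auto)
      then have "C v \<le> (\<Sum>v\<in>\<sigma>. \<bar>C v\<bar>) + 0" by linarith
      then have "C v * (\<Sum>i<k. \<bar>x i - y i\<bar>) + C v0 * (\<Sum>i<k. \<bar>x i - y i\<bar>)
          \<le> ((\<Sum>v\<in>\<sigma>. \<bar>C v\<bar>) + \<bar>C v0\<bar>) * (\<Sum>i<k. \<bar>x i - y i\<bar>)"
        using s unfolding distrib_right by (intro add_mono mult_right_mono) auto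
      then show ?thesis using C[OF xy, of v] C[OF xy, of v0] by linarith
    qed
    show "k < card (\<sigma> - {v0})" using card v0 fin by simp
  qed (use fin \<eta> in auto)
  define G where "G = (\<lambda>v x. g v x - (if v = v0 then 0 else c v))"
  have GF: "\<bar>G v x - F v x\<bar> \<le> \<eta>" if "x \<in> S" "v \<in> \<sigma>" for v x
  proof (cases "v = v0")
    case True
    then have "G v x = g v x" by (simp add: G_def)
    then show ?thesis using g(2)[OF that(1), of v] \<eta> by linarith
  next
    case False
    then have "G v x = g v x - c v" "\<bar>c v\<bar> < \<eta> / 2" using c(1)[of v] that(2) by (auto simp: G_def)
    then show ?thesis using g(2)[OF that(1), of v] \<eta> by linarith
  qed
  have Gex: "excess \<sigma> (\<lambda>v. G v x) > 0" if "x \<in> S" for x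
  proof -
    obtain v where "v \<in> \<sigma> - {v0}" "g v x - g v0 x \<noteq> c v" using c(2)[OF \<open>x \<in> S\<close>] by blast
    then show ?thesis by (intro excess_pos[OF fin, of v v0]) (auto simp: G_def v0)
  qed
  have Gcont: "continuous_on S (G v)" for v
    unfolding G_def using g(1)[of v] by (auto simp: R_def intro!: continuous_intros)
  define u where "u = (\<lambda>x. max 0 (min 1 (2 * excess \<sigma> (\<lambda>v. F v x) - 1)))"
  have "continuous_on S (\<lambda>x. Min ((\<lambda>v. F v x) ` \<sigma>))"
    by (rule continuous_on_Min) (use fin ne F in auto)
  then have ucont: "continuous_on S u"
    unfolding u_def excess_def by (intro continuous_intros F)
  define H where "H = (\<lambda>x v. u x * F v x + (1 - u x) * G v x)"
  have Hcont: "continuous_on S H"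
    unfolding H_def by (intro continuous_on_coordinatewise_then_product continuous_intros ucont F Gcont)
  have Hex: "excess \<sigma> (H x) > 0" if "x \<in> S" for x
  proof (cases "u x = 0")
    case True
    then show ?thesis using Gex[OF that] by (simp add: H_def)
  next
    case False
    then have "excess \<sigma> (\<lambda>v. F v x) > 1 / 2" by (auto simp: u_def)
    moreover have "excess \<sigma> (\<lambda>v. F v x) - 2 * \<eta> * real (card \<sigma>) \<le> excess \<sigma> (H x)"
    proof (rule excess_perturb[OF fin ne])
      fix v assume "v \<in> \<sigma>"
      have "H x v - F v x = (1 - u x) * (G v x - F v x)" by (simp add: H_def algebra_simps)
      then have "\<bar>H x v - F v x\<bar> = \<bar>1 - u x\<bar> * \<bar>G v x - F v x\<bar>" by (simp add: abs_mult)
      also have "\<dots> \<le> 1 * \<eta>"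
        by (intro mult_mono GF that) (auto simp: u_def \<open>v \<in> \<sigma>\<close>)
      finally show "\<bar>H x v - F v x\<bar> \<le> \<eta>" by simp
    qed
    moreover have "2 * \<eta> * real (card \<sigma>) = 1 / 4" using card by (simp add: \<eta>_def)
    ultimately show ?thesis by linarith
  qed
  show "\<exists>g. continuous_on S g \<and> g ` S \<subseteq> realization (simplex_boundary \<sigma>) \<and> (\<forall>x\<in>A. g x = f x)"
  proof (intro exI[of _ "\<lambda>x. push_to_boundary \<sigma> (H x)"] conjI ballI)
    show "continuous_on S (\<lambda>x. push_to_boundary \<sigma> (H x))"
      by (rule continuous_on_push_to_boundary[OF fin ne Hcont Hex])
    show "(\<lambda>x. push_to_boundary \<sigma> (H x)) ` S \<subseteq> realization (simplex_boundary \<sigma>)"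
      using push_to_boundary_in[OF fin Hex] by blast
    fix x assume x: "x \<in> A"
    then have "x \<in> S" using A closedin_imp_subset by blast
    have bx: "f x \<in> realization (simplex_boundary \<sigma>)" using f(2) x by blast
    have Fx: "(\<lambda>v. F v x) = f x" using F(2)[OF x] by blast
    then have "u x = 1" using boundary_excess(2)[OF fin bx] by (simp add: u_def)
    then have "H x = f x" using Fx by (simp add: H_def F(2)[OF x])
    then show "push_to_boundary \<sigma> (H x) = f x" using boundary_excess(3)[OF fin bx] by simp
  qed
qed

section \<open>Permanence of the extension property\<close>

lemma extends_to_boundary_homeomorphic:
  fixes \<phi> :: "'z::topological_space \<Rightarrow> 'y::t2_space"
  assumes E: "extends_to_boundary TYPE('v) n (\<phi> ` Z)" and "compact Z" "continuous_on Z \<phi>" "inj_on \<phi> Z"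
  shows "extends_to_boundary TYPE('v) n Z"
  unfolding extends_to_boundary_def
proof (intro allI impI, elim conjE)
  fix \<sigma> :: "'v set" and A f
  assume fin: "finite \<sigma>" and card: "n < card \<sigma>" and A: "closedin (top_of_set Z) A"
    and f: "continuous_on A f" "f ` A \<subseteq> realization (simplex_boundary \<sigma>)"
  obtain \<psi> where h: "homeomorphism Z (\<phi> ` Z) \<phi> \<psi>"
    using homeomorphism_compact assms(2-4) by blast
  have AZ: "A \<subseteq> Z" using A closedin_imp_subset by blast
  have \<psi>: "\<psi> (\<phi> x) = x" if "x \<in> Z" for x using h that by (simp add: homeomorphism_apply1)
  have "\<psi> ` \<phi> ` A = (\<lambda>x. x) ` A"
    unfolding image_image by (rule image_cong) (use \<psi> AZ in auto)
  then have im: "\<psi> ` \<phi> ` A = A" by simp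
  have "closedin (top_of_set (\<phi> ` Z)) (\<phi> ` A)"
    using homeomorphism_imp_closed_map[OF h A] .
  moreover have "continuous_on (\<phi> ` A) (f \<circ> \<psi>)"
  proof (rule continuous_on_compose)
    show "continuous_on (\<phi> ` A) \<psi>"
      using h AZ by (meson continuous_on_subset homeomorphism_cont2 image_mono)
    show "continuous_on (\<psi> ` \<phi> ` A) f" using f im by simp
  qed
  moreover have "(f \<circ> \<psi>) ` \<phi> ` A \<subseteq> realization (simplex_boundary \<sigma>)"
    unfolding image_comp[symmetric] im by (rule f(2))
  ultimately have "\<exists>g. continuous_on (\<phi> ` Z) g \<and> g ` \<phi> ` Z \<subseteq> realization (simplex_boundary \<sigma>) \<and> (\<forall>x\<in>\<phi> ` A. g x = (f \<circ> \<psi>) x)"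
    by (rule extends_to_boundaryD[OF E fin card])
  then obtain g where g: "continuous_on (\<phi> ` Z) g" "g ` \<phi> ` Z \<subseteq> realization (simplex_boundary \<sigma>)"
     "\<forall>x \<in> \<phi> ` A. g x = (f \<circ> \<psi>) x"
    by (elim exE conjE) (rule that; assumption)
  show "\<exists>g. continuous_on Z g \<and> g ` Z \<subseteq> realization (simplex_boundary \<sigma>) \<and> (\<forall>x\<in>A. g x = f x)"
  proof (intro exI[of _ "g \<circ> \<phi>"] conjI ballI)
    show "continuous_on Z (g \<circ> \<phi>)"
      using assms(3) g(1) by (rule continuous_on_compose)
    show "(g \<circ> \<phi>) ` Z \<subseteq> realization (simplex_boundary \<sigma>)" using g(2) by auto
    show "(g \<circ> \<phi>) x = f x" if "x \<in> A" for x using g(3) that \<psi> AZ by auto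
  qed
qed

lemma extends_to_boundary_mono:
  assumes "extends_to_boundary TYPE('v) n Z" "n \<le> m"
  shows "extends_to_boundary TYPE('v) m Z"
  using assms unfolding extends_to_boundary_def by (meson order_le_less_trans)

text \<open>The sum theorem of dimension theory for two closed pieces: extend over \<open>Z\<close>,
  glue with \<open>f\<close>, then extend over \<open>Y\<close> from the closed set
  \<open>(Z \<union> A) \<inter> Y\<close>.\<close>

lemma extends_to_boundary_Un:
  assumes E: "extends_to_boundary TYPE('v) n Z" "extends_to_boundary TYPE('v) n Y"
    and cl: "closedin (top_of_set (Z \<union> Y)) Z" "closedin (top_of_set (Z \<union> Y)) Y"
  shows "extends_to_boundary TYPE('v) n (Z \<union> Y)"
  unfolding extends_to_boundary_def
proof (intro allI impI, elim conjE)
  fix \<sigma> :: "'v set" and A f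
  assume fin: "finite \<sigma>" and card: "n < card \<sigma>" and A: "closedin (top_of_set (Z \<union> Y)) A"
    and f: "continuous_on A f" "f ` A \<subseteq> realization (simplex_boundary \<sigma>)"
  have AZY: "A \<subseteq> Z \<union> Y" using A closedin_imp_subset by blast
  have "closedin (top_of_set Z) (A \<inter> Z)"
    by (rule closedin_subset_trans[OF closedin_Int[OF A cl(1)]]) auto
  moreover have "continuous_on (A \<inter> Z) f" by (rule continuous_on_subset[OF f(1)]) auto
  moreover have "f ` (A \<inter> Z) \<subseteq> realization (simplex_boundary \<sigma>)" using f(2) by blast
  ultimately have "\<exists>g. continuous_on Z g \<and> g ` Z \<subseteq> realization (simplex_boundary \<sigma>) \<and> (\<forall>x\<in>A \<inter> Z. g x = f x)"
    by (rule extends_to_boundaryD[OF E(1) fin card])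
  then obtain g where g: "continuous_on Z g" "g ` Z \<subseteq> realization (simplex_boundary \<sigma>)" "\<forall>x \<in> A \<inter> Z. g x = f x"
    by (elim exE conjE) (rule that; assumption)
  define f' where "f' = (\<lambda>x. if x \<in> Z then g x else f x)"
  have "continuous_on (Z \<union> A) f'" unfolding f'_def
  proof (rule continuous_on_cases_local)
    show "closedin (top_of_set (Z \<union> A)) Z"
      by (rule closedin_subset_trans[OF cl(1)]) (use AZY in auto)
    show "closedin (top_of_set (Z \<union> A)) A"
      by (rule closedin_subset_trans[OF A]) (use AZY in auto)
  qed (use g f in auto)
  then have f': "continuous_on ((Z \<union> A) \<inter> Y) f'" by (rule continuous_on_subset) auto
  have "closedin (top_of_set Y) ((Z \<union> A) \<inter> Y)"
    by (rule closedin_subset_trans[OF closedin_Int[OF closedin_Un[OF cl(1) A] cl(2)]]) auto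
  moreover note f'
  moreover have "f' ` ((Z \<union> A) \<inter> Y) \<subseteq> realization (simplex_boundary \<sigma>)"
    using f(2) g(2) by (auto simp: f'_def)
  ultimately have "\<exists>g. continuous_on Y g \<and> g ` Y \<subseteq> realization (simplex_boundary \<sigma>) \<and> (\<forall>x\<in>(Z \<union> A) \<inter> Y. g x = f' x)"
    by (rule extends_to_boundaryD[OF E(2) fin card])
  then obtain h where h: "continuous_on Y h" "h ` Y \<subseteq> realization (simplex_boundary \<sigma>)"
      "\<forall>x \<in> (Z \<union> A) \<inter> Y. h x = f' x"
    by (elim exE conjE) (rule that; assumption)
  show "\<exists>g. continuous_on (Z \<union> Y) g \<and> g ` (Z \<union> Y) \<subseteq> realization (simplex_boundary \<sigma>) \<and> (\<forall>x\<in>A. g x = f x)"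
  proof (intro exI[of _ "\<lambda>x. if x \<in> Z then g x else h x"] conjI ballI)
    show "continuous_on (Z \<union> Y) (\<lambda>x. if x \<in> Z then g x else h x)"
      using cl g(1) h(1) by (rule continuous_on_cases_local) (use h(3) in \<open>auto simp: f'_def\<close>)
    show "(\<lambda>x. if x \<in> Z then g x else h x) ` (Z \<union> Y) \<subseteq> realization (simplex_boundary \<sigma>)"
      using g(2) h(2) by auto
    show "(if x \<in> Z then g x else h x) = f x" if "x \<in> A" for x
      using that AZY g(3) h(3) by (auto simp: f'_def)
  qed
qed

lemma extends_to_boundary_UN:
  assumes "finite I" "\<And>i. i \<in> I \<Longrightarrow> extends_to_boundary TYPE('v) n (Z i)" "\<And>i. i \<in> I \<Longrightarrow> closed (Z i)"
  shows "extends_to_boundary TYPE('v) n (\<Union>i\<in>I. Z i)"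
  using assms
proof (induction I)
  case empty
  then show ?case by (auto simp: extends_to_boundary_def)
next
  case (insert i I)
  then have "closed (\<Union>i\<in>I. Z i)" by auto
  then show ?case
    using insert extends_to_boundary_Un[where 'v='v, of n "Z i" "\<Union>i\<in>I. Z i"]
    by (simp add: closed_subset)
qed

section \<open>Finite complexes and spheres\<close>

definition finite_complex :: "'v set set \<Rightarrow> bool" where
  "finite_complex K \<longleftrightarrow> finite K \<and> (\<forall>F\<in>K. finite F) \<and> (\<forall>F\<in>K. \<forall>G. G \<subseteq> F \<longrightarrow> G \<in> K)"

lemma finite_complexD:
  assumes "finite_complex K"
  shows "finite K" "finite (\<Union>K)" "F \<in> K \<Longrightarrow> finite F" "F \<in> K \<Longrightarrow> G \<subseteq> F \<Longrightarrow> G \<in> K"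
  using assms by (auto simp: finite_complex_def)

lemma finite_complexI:
  assumes "finite_complex K" "L \<subseteq> K" "\<And>F G. F \<in> L \<Longrightarrow> G \<subseteq> F \<Longrightarrow> G \<in> L"
  shows "finite_complex L"
  using assms finite_subset unfolding finite_complex_def by (metis subsetD)

lemma realization_iff:
  assumes "finite_complex K"
  shows "x \<in> realization K \<longleftrightarrow> (\<forall>v. 0 \<le> x v) \<and> {v. x v \<noteq> 0} \<in> K \<and> (\<Sum>v\<in>\<Union>K. x v) = 1"
  by (rule realization_iff_sum) (use assms finite_complexD in auto)

lemma realization_mono: "L \<subseteq> K \<Longrightarrow> realization L \<subseteq> realization K"
  by (auto simp: realization_def)

text \<open>Tychonoff's theorem, for an arbitrary index type; realizations and spheres are closed
  subsets of such cubes.\<close>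

lemma compact_bounded_functions:
  fixes a b :: real
  shows "compact {x :: 'i \<Rightarrow> real. \<forall>i. a \<le> x i \<and> x i \<le> b}"
proof -
  have "compactin (product_topology (\<lambda>_. euclideanreal) (UNIV :: 'i set)) (PiE UNIV (\<lambda>_. {a..b}))"
    by (subst compactin_PiE) auto
  moreover have "PiE UNIV (\<lambda>_. {a..b}) = {x :: 'i \<Rightarrow> real. \<forall>i. a \<le> x i \<and> x i \<le> b}"
    by (auto simp: PiE_def Pi_def)
  ultimately show ?thesis by (simp add: euclidean_product_topology)
qed

text \<open>An intersection of closed conditions, from which closedness and compactness are read
  off.\<close>

lemma realization_Pow:
  assumes "finite F"
  shows "realization (Pow F) = (\<Inter>v. {x. 0 \<le> x v}) \<inter> (\<Inter>v\<in>-F. {x. x v = 0}) \<inter> {x. (\<Sum>v\<in>F. x v) = 1}"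
proof -
  have "\<Union>(Pow F) \<subseteq> F" by auto
  note iff = realization_iff_sum[OF assms this]
  have "x \<in> realization (Pow F) \<longleftrightarrow>
      x \<in> (\<Inter>v. {x. 0 \<le> x v}) \<inter> (\<Inter>v\<in>-F. {x. x v = 0}) \<inter> {x. (\<Sum>v\<in>F. x v) = 1}" for x
    unfolding iff by auto
  then show ?thesis by (intro equalityI subsetI) simp_all
qed

lemma compact_realization_Pow:
  assumes "finite F"
  shows "compact (realization (Pow F))"
proof -
  have c: "continuous_on UNIV (\<lambda>x :: 'a \<Rightarrow> real. x v)" for v by simp
  have "closed (realization (Pow F))"
    unfolding realization_Pow[OF assms]
    by (intro closed_Int closed_INT ballI closed_Collect_le closed_Collect_eq continuous_on_sum continuous_on_const c)
  moreover have "realization (Pow F) \<subseteq> {x. \<forall>v. 0 \<le> x v \<and> x v \<le> 1}"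
  proof
    fix x assume x: "x \<in> realization (Pow F)"
    have "\<bar>x v\<bar> \<le> 1" for v
      by (rule realization_le_1[OF assms _ x]) auto
    then have "x v \<le> 1" for v by (rule abs_le_D1)
    moreover have "0 \<le> x v" for v using x by (simp add: realization_def)
    ultimately show "x \<in> {x. \<forall>v. 0 \<le> x v \<and> x v \<le> 1}" by simp
  qed
  ultimately show ?thesis
    using compact_Int_closed[OF compact_bounded_functions, of "realization (Pow F)" 0 1] by (simp only: Int_absorb1)
qed

lemma realization_UN:
  assumes "finite_complex K"
  shows "realization K = (\<Union>F\<in>K. realization (Pow F))"
  using finite_complexD(4)[OF assms] by (auto simp: realization_def)

lemma closed_realization:
  assumes "finite_complex K"
  shows "closed (realization K)"
proof -
  have c: "continuous_on UNIV (\<lambda>x :: 'a \<Rightarrow> real. x v)" for v by simp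
  have "closed (realization (Pow F))" if "F \<in> K" for F
    unfolding realization_Pow[OF finite_complexD(3)[OF assms that]]
    by (intro closed_Int closed_INT ballI closed_Collect_le closed_Collect_eq continuous_on_sum continuous_on_const c)
  then show ?thesis unfolding realization_UN[OF assms]
    by (intro closed_UN) (auto simp: finite_complexD[OF assms])
qed

text \<open>On a compact set, \<open>k\<close> continuous functions that separate points are an
  embedding into k-dimensional space; padding with zeros brings the image into the form of
  \<open>compact_cube_extends_to_boundary\<close>.\<close>

lemma coordinates_extend_to_boundary:
  fixes c :: "nat \<Rightarrow> 'z::topological_space \<Rightarrow> real"
  assumes "compact Z" "\<And>i. i < k \<Longrightarrow> continuous_on Z (c i)"
    "\<And>x y. x \<in> Z \<Longrightarrow> y \<in> Z \<Longrightarrow> (\<And>i. i < k \<Longrightarrow> c i x = c i y) \<Longrightarrow> x = y"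
  shows "extends_to_boundary TYPE('v) (Suc k) Z"
proof (rule extends_to_boundary_homeomorphic)
  define \<phi> where "\<phi> = (\<lambda>z i. if i < k then c i z else 0)"
  show cont: "continuous_on Z \<phi>" unfolding \<phi>_def
  proof (rule continuous_on_coordinatewise_then_product)
    show "continuous_on Z (\<lambda>x. if i < k then c i x else 0)" for i
      using assms(2)[of i] by (cases "i < k") auto
  qed
  show "extends_to_boundary TYPE('v) (Suc k) (\<phi> ` Z)"
  proof (rule compact_cube_extends_to_boundary)
    show "compact (\<phi> ` Z)" by (rule compact_continuous_image[OF cont assms(1)])
    show "x i = 0" if "x \<in> \<phi> ` Z" "k \<le> i" for x i using that by (auto simp: \<phi>_def)
  qed
  show "inj_on \<phi> Z"
  proof (rule inj_onI)
    fix x y assume xy: "x \<in> Z" "y \<in> Z" "\<phi> x = \<phi> y"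
    show "x = y"
    proof (rule assms(3)[OF xy(1,2)])
      show "c i x = c i y" if "i < k" for i
        using fun_cong[OF xy(3), of i] that by (simp add: \<phi>_def)
    qed
  qed
qed fact

text \<open>The coordinates sum to 1, so one of them may be dropped and \<open>card F - 1\<close>
  still separate points.\<close>

lemma realization_Pow_extends_to_boundary:
  assumes "finite F"
  shows "extends_to_boundary TYPE('v) (card F) (realization (Pow F))"
proof (cases "F = {}")
  case True
  then have "realization (Pow F) = {}" unfolding realization_Pow[OF assms] by simp
  then show ?thesis by (simp add: extends_to_boundary_def)
next
  case False
  then obtain v0 where v0: "v0 \<in> F" by blast
  define k where "k = card (F - {v0})"
  have k: "card F = Suc k" using assms v0 by (metis card.remove k_def)
  obtain e where e: "bij_betw e {..<k} (F - {v0})"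
    using ex_bij_betw_nat_finite[of "F - {v0}"] assms by (auto simp: k_def atLeast0LessThan)
  show ?thesis unfolding k
  proof (rule coordinates_extend_to_boundary[where c = "\<lambda>i x. x (e i)"])
    show "compact (realization (Pow F))" by (rule compact_realization_Pow[OF assms])
    show "continuous_on (realization (Pow F)) (\<lambda>x. x (e i))" for i
      by (rule continuous_on_subset[OF continuous_on_product_coordinates]) auto
    fix x y assume x: "x \<in> realization (Pow F)" and y: "y \<in> realization (Pow F)"
      and eq: "\<And>i. i < k \<Longrightarrow> x (e i) = y (e i)"
    have e1: "x v = y v" if "v \<in> F - {v0}" for v
      using eq bij_betw_imp_surj_on[OF e] that by (metis imageE lessThan_iff)
    have "(\<Sum>v\<in>F. x v) = 1" "(\<Sum>v\<in>F. y v) = 1"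
      using x y unfolding realization_Pow[OF assms] by blast+
    then have "x v0 + (\<Sum>v\<in>F - {v0}. x v) = y v0 + (\<Sum>v\<in>F - {v0}. y v)"
      using sum.remove[OF assms v0, of x] sum.remove[OF assms v0, of y] by simp
    moreover have "(\<Sum>v\<in>F - {v0}. x v) = (\<Sum>v\<in>F - {v0}. y v)"
      by (rule sum.cong) (use e1 in auto)
    ultimately have e0: "x v0 = y v0" by simp
    have "x v = y v" if "v \<notin> F" for v
      using x y that unfolding realization_Pow[OF assms] by simp
    with e1 e0 show "x = y" by (metis DiffI ext singletonD)
  qed
qed

lemma realization_extends_to_boundary:
  assumes "finite_complex K" "\<And>F. F \<in> K \<Longrightarrow> card F \<le> n"
  shows "extends_to_boundary TYPE('v) n (realization K)"
  unfolding realization_UN[OF assms(1)]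
proof (rule extends_to_boundary_UN)
  fix F assume F: "F \<in> K"
  then have fF: "finite F" by (rule finite_complexD(3)[OF assms(1)])
  show "extends_to_boundary TYPE('v) n (realization (Pow F))"
    using extends_to_boundary_mono[OF realization_Pow_extends_to_boundary[OF fF] assms(2)[OF F]] .
  show "closed (realization (Pow F))"
    by (rule closed_realization) (use fF in \<open>auto simp: finite_complex_def intro: finite_subset\<close>)
qed (rule finite_complexD[OF assms(1)])

definition sphere_set :: "nat \<Rightarrow> (nat \<Rightarrow> real) set" where
  "sphere_set p = {x. (\<Sum>i\<le>p. x i ^ 2) = 1 \<and> (\<forall>i>p. x i = 0)}"

lemma nsphere_eq: "nsphere p = top_of_set (sphere_set p)"
  by (simp add: nsphere sphere_set_def euclidean_product_topology)

lemma compact_sphere_set: "compact (sphere_set p)"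
proof -
  have c: "continuous_on UNIV (\<lambda>x :: nat \<Rightarrow> real. x v)" for v by simp
  have "sphere_set p = {x. (\<Sum>i\<le>p. x i ^ 2) = 1} \<inter> (\<Inter>i\<in>{p<..}. {x. x i = 0})"
    by (auto simp: sphere_set_def)
  also have "closed \<dots>"
    by (intro closed_Int closed_INT ballI closed_Collect_eq continuous_on_sum continuous_on_power continuous_on_const c)
  finally have "closed (sphere_set p)" .
  moreover have "sphere_set p \<subseteq> {x. \<forall>i. -1 \<le> x i \<and> x i \<le> 1}"
  proof (intro subsetI CollectI allI)
    fix x i assume x: "x \<in> sphere_set p"
    have "(x i)\<^sup>2 \<le> 1"
    proof (cases "i \<le> p")
      case True
      then have "(x i)\<^sup>2 \<le> (\<Sum>i\<le>p. x i ^ 2)" by (intro member_le_sum) auto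
      then show ?thesis using x by (simp add: sphere_set_def)
    qed (use x in \<open>simp add: sphere_set_def\<close>)
    then have "\<bar>x i\<bar> \<le> 1" by (simp add: abs_square_le_1)
    then show "-1 \<le> x i \<and> x i \<le> 1" by linarith
  qed
  ultimately show ?thesis
    using compact_Int_closed[OF compact_bounded_functions, of "sphere_set p" "-1" 1] by (simp only: Int_absorb1)
qed

text \<open>The first \<open>p\<close> coordinates separate the points of each closed hemisphere.\<close>
lemma sphere_extends_to_boundary: "extends_to_boundary TYPE('v) (Suc p) (sphere_set p)"
proof -
  have c: "continuous_on UNIV (\<lambda>x :: nat \<Rightarrow> real. x v)" for v by simp
  define H where "H = (\<lambda>s :: real. sphere_set p \<inter> {x. 0 \<le> s * x p})"
  have clH: "compact (H s)" for s
    unfolding H_def by (intro compact_Int_closed compact_sphere_set closed_Collect_le continuous_on_mult c continuous_on_const)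
  have cl: "closed (H s)" for s
  proof -
    have "sphere_set p = {x. (\<Sum>i\<le>p. x i ^ 2) = 1} \<inter> (\<Inter>i\<in>{p<..}. {x. x i = 0})"
      by (auto simp: sphere_set_def)
    then show ?thesis unfolding H_def
      by (auto intro!: closed_Int closed_INT ballI closed_Collect_eq closed_Collect_le continuous_on_sum continuous_on_power
          continuous_on_mult continuous_on_const c)
  qed
  have "extends_to_boundary TYPE('v) (Suc p) (H s)" if s: "s = 1 \<or> s = -1" for s
  proof (rule coordinates_extend_to_boundary[where c = "\<lambda>i x. x i"])
    show "compact (H s)" by (rule clH)
    show "continuous_on (H s) (\<lambda>x. x i)" for i
      by (rule continuous_on_subset[OF continuous_on_product_coordinates]) auto
    fix x y assume xy: "x \<in> H s" "y \<in> H s" and eq: "\<And>i. i < p \<Longrightarrow> x i = y i"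
    have "(\<Sum>i\<le>p. x i ^ 2) = (\<Sum>i<p. x i ^ 2) + x p ^ 2" for x :: "nat \<Rightarrow> real"
      by (simp add: lessThan_Suc_atMost[symmetric])
    moreover have "(\<Sum>i<p. x i ^ 2) = (\<Sum>i<p. y i ^ 2)" using eq by simp
    moreover have "(\<Sum>i\<le>p. x i ^ 2) = 1" "(\<Sum>i\<le>p. y i ^ 2) = 1"
      using xy by (auto simp: H_def sphere_set_def)
    ultimately have "(x p)\<^sup>2 = (y p)\<^sup>2" by (metis add_left_cancel)
    then have "x p = y p \<or> x p = - y p" by (simp add: power2_eq_iff)
    moreover have "0 \<le> s * x p" "0 \<le> s * y p" using xy by (auto simp: H_def)
    ultimately have p: "x p = y p" using s by auto
    have "x i = 0" "y i = 0" if "i > p" for i using xy that by (auto simp: H_def sphere_set_def)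
    with p eq show "x = y" by (metis ext linorder_neqE_nat)
  qed
  then have "extends_to_boundary TYPE('v) (Suc p) (\<Union>s\<in>{1,-1}. H s)"
    by (intro extends_to_boundary_UN cl) auto
  moreover have "(\<Union>s\<in>{1,-1}. H s) = sphere_set p"
    by (auto simp: H_def)
  ultimately show ?thesis by simp
qed

text \<open>Along the segment the support stays inside the union of the two supports, so it is a
  face whenever that union is one.\<close>

lemma linear_homotopy:
  fixes f g :: "'z::topological_space \<Rightarrow> 'v \<Rightarrow> real"
  assumes K: "finite_complex K" and cont: "continuous_on Z f" "continuous_on Z g"
    and im: "\<And>z. z \<in> Z \<Longrightarrow> f z \<in> realization K" "\<And>z. z \<in> Z \<Longrightarrow> g z \<in> realization K"
    and common: "\<And>z. z \<in> Z \<Longrightarrow> {v. f z v \<noteq> 0} \<union> {v. g z v \<noteq> 0} \<in> K"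
  shows "homotopic_with_canon (\<lambda>_. True) Z (realization K) f g"
  unfolding homotopic_with_def
proof (intro exI conjI allI ballI TrueI)
  let ?h = "\<lambda>tz v. (1 - fst tz) * f (snd tz) v + fst tz * g (snd tz) v"
  have "continuous_on ({0..1} \<times> Z) ?h"
  proof (rule continuous_on_coordinatewise_then_product)
    fix v
    have "continuous_on ({0..1} \<times> Z) (\<lambda>tz. f (snd tz) v)" "continuous_on ({0..1} \<times> Z) (\<lambda>tz. g (snd tz) v)"
      by (auto intro!: continuous_on_compose2[OF continuous_on_product_then_coordinatewise[OF cont(1)]]
          continuous_on_compose2[OF continuous_on_product_then_coordinatewise[OF cont(2)]] continuous_on_snd continuous_on_id)
    then show "continuous_on ({0..1} \<times> Z) (\<lambda>tz. ?h tz v)"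
      by (intro continuous_intros)
  qed
  moreover have "?h (t, z) \<in> realization K" if t: "0 \<le> t" "t \<le> 1" and z: "z \<in> Z" for t z
  proof -
    have f: "\<forall>v. 0 \<le> f z v" "(\<Sum>v\<in>\<Union>K. f z v) = 1" using im(1)[OF z] realization_iff[OF K] by blast+
    have g: "\<forall>v. 0 \<le> g z v" "(\<Sum>v\<in>\<Union>K. g z v) = 1" using im(2)[OF z] realization_iff[OF K] by blast+
    have "{v. ?h (t, z) v \<noteq> 0} \<subseteq> {v. f z v \<noteq> 0} \<union> {v. g z v \<noteq> 0}" by auto
    then have "{v. ?h (t, z) v \<noteq> 0} \<in> K" by (rule finite_complexD(4)[OF K common[OF z]])
    moreover have "\<forall>v. 0 \<le> ?h (t, z) v" using f g t by simp
    moreover have "(\<Sum>v\<in>\<Union>K. ?h (t, z) v) = 1"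
      using f g by (simp add: sum.distrib flip: sum_distrib_left)
    ultimately show ?thesis using realization_iff[OF K] by blast
  qed
  ultimately show "continuous_map (prod_topology (top_of_set {0..1}) (top_of_set Z)) (top_of_set (realization K)) ?h"
    by (auto simp: prod_topology_subtopology_eu)
qed auto

lemma finite_complex_simplex_boundary: "finite \<sigma> \<Longrightarrow> finite_complex (simplex_boundary \<sigma>)"
  by (auto simp: finite_complex_def simplex_boundary_def intro: finite_subset)

section \<open>Cellular approximation\<close>

text \<open>Faces with more than \<open>n\<close> vertices are emptied one at a time, largest first.
  Over the closed simplex \<open>\<sigma>\<close> the map is replaced by an extension of its part
  over the boundary of \<open>\<sigma>\<close>, which exists because
  \<open>n < card \<sigma>\<close>.\<close>

lemma cellular_approximation:
  fixes f :: "'z::topological_space \<Rightarrow> 'v \<Rightarrow> real"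
  assumes E: "extends_to_boundary TYPE('v) n Z"
  shows "finite_complex K \<Longrightarrow> continuous_on Z f \<Longrightarrow> f ` Z \<subseteq> realization K \<Longrightarrow>
    \<exists>g. continuous_on Z g \<and> g ` Z \<subseteq> realization {F \<in> K. card F \<le> n} \<and>
        homotopic_with_canon (\<lambda>_. True) Z (realization K) f g"
proof (induction "card {F \<in> K. n < card F}" arbitrary: K f)
  case 0
  have "finite {F \<in> K. n < card F}" using finite_complexD(1)[OF 0(2)] by simp
  then have "{F \<in> K. n < card F} = {}" using 0(1) by simp
  then have K: "{F \<in> K. card F \<le> n} = K" by (auto simp: not_less)
  have "homotopic_with_canon (\<lambda>_. True) Z (realization K) f f"
    using 0(3,4) by (auto simp: homotopic_with_refl)
  then show ?case unfolding K using 0(3,4) by (intro exI[of _ f] conjI)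
next
  case (Suc m)
  note K = finite_complexD[OF Suc(3)]
  have "{F \<in> K. n < card F} \<noteq> {}" using Suc(2) by (metis card.empty nat.distinct(1))
  then obtain F0 where F0: "F0 \<in> K" "n < card F0" by blast
  have "Max (card ` K) \<in> card ` K" using F0 K(1) by (intro Max_in) auto
  \<comment> \<open>Maximal cardinality makes \<open>\<sigma>\<close> a facet, so removing it leaves
    a complex.\<close>
  then obtain \<sigma> where \<sigma>: "\<sigma> \<in> K" "card \<sigma> = Max (card ` K)" by auto
  have max: "card F \<le> card \<sigma>" if "F \<in> K" for F using \<sigma>(2) that K(1) by simp
  have n: "n < card \<sigma>" using max[OF F0(1)] F0(2) by simp
  have fin: "finite \<sigma>" using K(3) \<sigma>(1) by blast
  define K' where "K' = K - {\<sigma>}"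
  have K': "finite_complex K'"
  proof (rule finite_complexI[OF Suc(3)])
    show "K' \<subseteq> K" by (auto simp: K'_def)
    fix F G assume F: "F \<in> K'" and G: "G \<subseteq> F"
    have "G \<noteq> \<sigma>"
    proof
      assume "G = \<sigma>"
      then have "\<sigma> = F"
        using F G max K(3) by (intro card_seteq) (auto simp: K'_def)
      then show False using F by (simp add: K'_def)
    qed
    then show "G \<in> K'" using F G K(4) by (auto simp: K'_def)
  qed
  define Rb where "Rb = realization (simplex_boundary \<sigma>)"
  define Rs where "Rs = realization (Pow \<sigma>)"
  have cl: "closed Rb" "closed Rs" "closed (realization K')"
    unfolding Rb_def Rs_def
    using closed_realization[OF finite_complex_simplex_boundary[OF fin]] closed_realization[OF K']
      compact_realization_Pow[OF fin] closed_realization[of "Pow \<sigma>"] fin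
    by (auto simp: finite_complex_def intro: finite_subset)
  have bK': "Rb \<subseteq> realization K'" unfolding Rb_def
    by (rule realization_mono) (use \<sigma> K(4) in \<open>auto simp: simplex_boundary_def K'_def\<close>)
  have K'K: "realization K' \<subseteq> realization K"
    by (rule realization_mono) (auto simp: K'_def)
  have bs: "Rb \<subseteq> Rs" unfolding Rb_def Rs_def
    by (rule realization_mono) (auto simp: simplex_boundary_def)
  have inter: "x \<in> Rb" if "x \<in> Rs" "x \<in> realization K'" for x
    using that by (auto simp: Rb_def Rs_def realization_def simplex_boundary_def K'_def)
  have diff: "x \<in> realization K'" if "x \<in> realization K" "x \<notin> Rs" for x
    using that by (auto simp: Rs_def realization_def K'_def)
  have fK: "f z \<in> realization K" if "z \<in> Z" for z using Suc(5) that by blast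
  \<comment> \<open>The extension is taken over all of \<open>Z\<close>, but its values are used
    only over the closed simplex; elsewhere \<open>f\<close> is kept.\<close>
  have "\<exists>g. continuous_on Z g \<and> g ` Z \<subseteq> realization (simplex_boundary \<sigma>) \<and> (\<forall>x\<in>Z \<inter> f -` Rb. g x = f x)"
  proof (rule extends_to_boundaryD[OF E fin n])
    show "closedin (top_of_set Z) (Z \<inter> f -` Rb)"
      by (rule continuous_closedin_preimage[OF Suc(4) cl(1)])
    show "continuous_on (Z \<inter> f -` Rb) f"
      by (rule continuous_on_subset[OF Suc(4)]) auto
    show "f ` (Z \<inter> f -` Rb) \<subseteq> realization (simplex_boundary \<sigma>)" by (auto simp: Rb_def)
  qed
  then obtain e where e: "continuous_on Z e" "e ` Z \<subseteq> realization (simplex_boundary \<sigma>)"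
    "\<forall>x\<in>Z \<inter> f -` Rb. e x = f x" by (elim exE conjE) (rule that; assumption)
  have eR: "e z \<in> Rb" if "z \<in> Z" for z using e(2) that by (auto simp: Rb_def)
  define f' where "f' = (\<lambda>z. if f z \<in> Rs then e z else f z)"
  have Zeq: "Z \<inter> f -` Rs \<union> Z \<inter> f -` realization K' = Z"
    using fK diff by auto
  have "continuous_on (Z \<inter> f -` Rs \<union> Z \<inter> f -` realization K') f'"
    unfolding f'_def
  proof (rule continuous_on_cases_local)
    show "closedin (top_of_set (Z \<inter> f -` Rs \<union> Z \<inter> f -` realization K')) (Z \<inter> f -` Rs)"
      unfolding Zeq by (rule continuous_closedin_preimage[OF Suc(4) cl(2)])
    show "closedin (top_of_set (Z \<inter> f -` Rs \<union> Z \<inter> f -` realization K')) (Z \<inter> f -` realization K')"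
      unfolding Zeq by (rule continuous_closedin_preimage[OF Suc(4) cl(3)])
    show "continuous_on (Z \<inter> f -` Rs) e" by (rule continuous_on_subset[OF e(1)]) auto
    show "continuous_on (Z \<inter> f -` realization K') f" by (rule continuous_on_subset[OF Suc(4)]) auto
    show "e x = f x" if "x \<in> Z \<inter> f -` Rs \<and> f x \<notin> Rs \<or> x \<in> Z \<inter> f -` realization K' \<and> f x \<in> Rs" for x
      using that e(3) inter by auto
  qed
  then have cf': "continuous_on Z f'" unfolding Zeq .
  have f'K': "f' z \<in> realization K'" if "z \<in> Z" for z
    using that eR bK' diff fK by (auto simp: f'_def)
  \<comment> \<open>Wherever the map changed, old and new value lie in the same closed simplex
    \<open>\<sigma>\<close>.\<close>
  have "homotopic_with_canon (\<lambda>_. True) Z (realization K) f f'"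
  proof (rule linear_homotopy[OF Suc(3) Suc(4) cf' fK])
    show "f' z \<in> realization K" if "z \<in> Z" for z using f'K'[OF that] K'K by blast
    show "{v. f z v \<noteq> 0} \<union> {v. f' z v \<noteq> 0} \<in> K" if z: "z \<in> Z" for z
    proof (cases "f z \<in> Rs")
      case True
      moreover have "e z \<in> Rs" using eR[OF z] bs by blast
      ultimately have "{v. f z v \<noteq> 0} \<union> {v. f' z v \<noteq> 0} \<subseteq> \<sigma>"
        unfolding f'_def Rs_def realization_def by auto
      then show ?thesis by (rule K(4)[OF \<sigma>(1)])
    next
      case False
      then show ?thesis using fK[OF z] by (simp add: f'_def realization_def)
    qed
  qed auto
  moreover have "\<exists>g. continuous_on Z g \<and> g ` Z \<subseteq> realization {F \<in> K'. card F \<le> n} \<and>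
        homotopic_with_canon (\<lambda>_. True) Z (realization K') f' g"
  proof (rule Suc(1)[OF _ K' cf'])
    have "{F \<in> K'. n < card F} = {F \<in> K. n < card F} - {\<sigma>}" by (auto simp: K'_def)
    then show "m = card {F \<in> K'. n < card F}"
      using Suc(2) \<sigma>(1) n K(1) by simp
    show "f' ` Z \<subseteq> realization K'" using f'K' by blast
  qed
  then obtain g where g: "continuous_on Z g" "g ` Z \<subseteq> realization {F \<in> K'. card F \<le> n}"
        "homotopic_with_canon (\<lambda>_. True) Z (realization K') f' g" by (elim exE conjE) (rule that; assumption)
  have "homotopic_with_canon (\<lambda>_. True) Z (realization K) f' g"
    by (rule homotopic_with_subset_right[OF g(3) K'K])
  ultimately have "homotopic_with_canon (\<lambda>_. True) Z (realization K) f g"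
    by (rule homotopic_with_trans)
  moreover have "{F \<in> K'. card F \<le> n} = {F \<in> K. card F \<le> n}" using n by (auto simp: K'_def)
  ultimately show ?case using g(1,2) by (intro exI[of _ g]) simp
qed

section \<open>Contracting skeleta of coned complexes\<close>

text \<open>\<open>v\<close> is not required to lie outside \<open>S\<close>.\<close>
definition coned :: "nat \<Rightarrow> 'v set set \<Rightarrow> bool" where
  "coned m K \<longleftrightarrow> (\<forall>S. finite S \<and> card S \<le> m \<longrightarrow> (\<exists>v. \<forall>F\<in>K. F \<subseteq> S \<longrightarrow> insert v F \<in> K))"

text \<open>The intersection of the closed stars of all faces inside \<open>S\<close>. Its faces may
  meet \<open>S\<close>, unlike those of a link in the strict sense.\<close>

definition common_link :: "'v set set \<Rightarrow> 'v set \<Rightarrow> 'v set set" where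
  "common_link K S = {F \<in> K. \<forall>G\<in>K. G \<subseteq> S \<longrightarrow> F \<union> G \<in> K}"

lemma common_link_antimono: "S \<subseteq> T \<Longrightarrow> common_link K T \<subseteq> common_link K S"
  by (auto simp: common_link_def)

lemma common_link_subset: "common_link K S \<subseteq> K"
  by (auto simp: common_link_def)

lemma empty_in_common_link: "{} \<in> K \<Longrightarrow> {} \<in> common_link K S"
  by (auto simp: common_link_def)

lemma finite_complex_common_link:
  assumes "finite_complex K"
  shows "finite_complex (common_link K S)"
proof (rule finite_complexI[OF assms common_link_subset])
  fix F G assume F: "F \<in> common_link K S" and G: "G \<subseteq> F"
  have "G \<union> H \<in> K" if "H \<in> K" "H \<subseteq> S" for H
  proof (rule finite_complexD(4)[OF assms])
    show "F \<union> H \<in> K" using F that by (auto simp: common_link_def)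
    show "G \<union> H \<subseteq> F \<union> H" using G by auto
  qed
  moreover have "G \<in> K" using F G finite_complexD(4)[OF assms] by (auto simp: common_link_def)
  ultimately show "G \<in> common_link K S" by (simp add: common_link_def)
qed

text \<open>The vertex for \<open>S \<union> T\<close> in \<open>K\<close> serves \<open>T\<close>
  in the common link: if \<open>F\<close> lies in the link and in \<open>T\<close>, and
  \<open>G\<close> is a face in \<open>S\<close>, then \<open>F \<union> G\<close> is a face inside
  \<open>S \<union> T\<close>, to which the vertex can be added.\<close>

lemma coned_common_link:
  assumes K: "finite_complex K" and con: "coned m K" and S: "finite S" "card S + l \<le> m"
  shows "coned l (common_link K S)"
  unfolding coned_def
proof (intro allI impI, elim conjE)
  fix T :: "'a set" assume T: "finite T" "card T \<le> l"
  have "card (S \<union> T) \<le> m" using card_Un_le[of S T] T S by linarith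
  then obtain v where v: "\<And>F. F \<in> K \<Longrightarrow> F \<subseteq> S \<union> T \<Longrightarrow> insert v F \<in> K"
    using con S T unfolding coned_def by (meson finite_UnI)
  show "\<exists>v. \<forall>F\<in>common_link K S. F \<subseteq> T \<longrightarrow> insert v F \<in> common_link K S"
  proof (intro exI ballI impI)
    fix F assume F: "F \<in> common_link K S" "F \<subseteq> T"
    then have FK: "F \<in> K" by (simp add: common_link_def)
    have "insert v F \<union> G \<in> K" if "G \<in> K" "G \<subseteq> S" for G
      using v[of "F \<union> G"] F that by (auto simp: common_link_def)
    moreover have "insert v F \<in> K" using v[OF FK] F by auto
    ultimately show "insert v F \<in> common_link K S" by (simp add: common_link_def)
  qed
qed

text \<open>For the nonempty faces of a complex this is its barycentric subdivision; for the members
  above a given face it is a cone.\<close>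

definition order_complex :: "'v set set \<Rightarrow> 'v set set set" where
  "order_complex U = {C. C \<subseteq> U \<and> (\<forall>s\<in>C. \<forall>t\<in>C. s \<subseteq> t \<or> t \<subseteq> s)}"

lemma order_complex_mono: "U \<subseteq> W \<Longrightarrow> order_complex U \<subseteq> order_complex W"
  by (auto simp: order_complex_def)

lemma finite_complex_order_complex: "finite U \<Longrightarrow> finite_complex (order_complex U)"
  unfolding finite_complex_def order_complex_def
  by (auto intro: finite_subset[of _ "Pow U"] finite_subset[of _ U] simp: subset_eq)

lemma Union_order_complex_subset: "\<Union>(order_complex U) \<subseteq> U"
  by (auto simp: order_complex_def)

lemma realization_order_complex_iff:
  assumes "finite U"
  shows "q \<in> realization (order_complex U) \<longleftrightarrow> (\<forall>s. 0 \<le> q s) \<and> {s. q s \<noteq> 0} \<in> order_complex U \<and> (\<Sum>s\<in>U. q s) = 1"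
  by (rule realization_iff_sum[OF assms Union_order_complex_subset])

lemma realization_order_complex_restrict:
  assumes "q \<in> realization (order_complex U)" "{s. q s \<noteq> 0} \<subseteq> W"
  shows "q \<in> realization (order_complex W)"
  using assms by (simp add: realization_def order_complex_def)

text \<open>The support is a finite nonempty chain, so it has a least member. Carrier conditions are
  stated for stars above a member, and this puts every point into such a star.\<close>

lemma realization_order_complex_least:
  assumes "finite U" "q \<in> realization (order_complex U)"
  obtains \<tau> where "\<tau> \<in> U" "q \<tau> \<noteq> 0" "q \<in> realization (order_complex {s \<in> U. \<tau> \<subseteq> s})"
proof -
  have q: "{s. q s \<noteq> 0} \<subseteq> U" "\<And>s t. q s \<noteq> 0 \<Longrightarrow> q t \<noteq> 0 \<Longrightarrow> s \<subseteq> t \<or> t \<subseteq> s"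
    "(\<Sum>s | q s \<noteq> 0. q s) = 1"
    using assms(2) by (auto simp: realization_def order_complex_def)
  have "{s. q s \<noteq> 0} \<noteq> {}"
  proof
    assume e: "{s. q s \<noteq> 0} = {}"
    show False using q(3) unfolding e by simp
  qed
  moreover have "finite {s. q s \<noteq> 0}" using q(1) assms(1) by (rule finite_subset)
  ultimately obtain \<tau> where \<tau>: "\<tau> \<in> {s. q s \<noteq> 0}" "\<And>b. b \<in> {s. q s \<noteq> 0} \<Longrightarrow> b \<subseteq> \<tau> \<Longrightarrow> \<tau> = b"
    by (metis finite_has_minimal)
  have "{s. q s \<noteq> 0} \<subseteq> {s \<in> U. \<tau> \<subseteq> s}"
  proof
    fix s assume s: "s \<in> {s. q s \<noteq> 0}"
    then have "\<tau> \<subseteq> s" using q(2)[of s \<tau>] \<tau> by auto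
    then show "s \<in> {s \<in> U. \<tau> \<subseteq> s}" using s q(1) by auto
  qed
  then have "q \<in> realization (order_complex {s \<in> U. \<tau> \<subseteq> s})"
    by (rule realization_order_complex_restrict[OF assms(2)])
  then show thesis using \<tau>(1) q(1) by (intro that[of \<tau>]) auto
qed

text \<open>Members of a chain have distinct cardinalities, all in the range from l + 1 to n. This
  is the drop in dimension that the induction uses.\<close>

lemma card_chain_above:
  assumes C: "C \<in> order_complex W" and W: "\<And>s. s \<in> W \<Longrightarrow> finite s \<and> l < card s \<and> card s \<le> n"
  shows "card C \<le> n - l"
proof -
  have CW: "C \<subseteq> W" using C by (simp add: order_complex_def)
  have "inj_on card C"
  proof (rule inj_onI)
    fix s t assume st: "s \<in> C" "t \<in> C" "card s = card t"
    then have "s \<subseteq> t \<or> t \<subseteq> s" using C by (auto simp: order_complex_def)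
    moreover have "finite s" "finite t" using st W CW by auto
    ultimately show "s = t" using st(3) card_subset_eq by metis
  qed
  then have "card C = card (card ` C)" by (simp add: card_image)
  also have "\<dots> \<le> card {l<..n}" using W CW by (intro card_mono) auto
  finally show ?thesis by simp
qed

text \<open>
  Since \<open>\<tau>\<close> is minimal, \<open>order_complex {s \<in> U. \<tau> \<subseteq> s}\<close> is a cone with apex \<open>\<tau>\<close>; the null homotopy runs
  along the lower half of the cone lines, which avoids a continuity argument at the apex.
\<close>
lemma continuous_on_extend_cone:
  fixes h' :: "('v set \<Rightarrow> real) \<Rightarrow> 'v \<Rightarrow> real"
  assumes U: "finite U" and \<tau>: "\<tau> \<in> U" and min: "\<And>s. s \<in> U \<Longrightarrow> s \<subseteq> \<tau> \<Longrightarrow> s = \<tau>"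
    and W: "W = {s \<in> U. \<tau> \<subset> s}"
    and h': "continuous_on (realization (order_complex (U - {\<tau>}))) h'"
    and hom: "homotopic_with_canon (\<lambda>_. True) (realization (order_complex W)) R h' (\<lambda>_. c)"
    and c: "c \<in> R"
  obtains h where "continuous_on (realization (order_complex U)) h"
    "\<forall>q\<in>realization (order_complex (U - {\<tau>})). h q = h' q"
    "\<forall>q\<in>realization (order_complex {s \<in> U. \<tau> \<subseteq> s}). h q \<in> R"
proof -
  obtain H :: "real \<times> ('v set \<Rightarrow> real) \<Rightarrow> 'v \<Rightarrow> real" where H: "continuous_map (prod_topology (top_of_set {0..1}) (top_of_set (realization (order_complex W)))) (top_of_set R) H"
    and H01: "\<forall>x. H (0, x) = h' x" "\<forall>x. H (1, x) = c"
    using hom unfolding homotopic_with_def by (elim exE conjE) (rule that; assumption)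
  have H0: "H (0, x) = h' x" and H1: "H (1, x) = c" for x
    using H01 by simp_all
  have Hc: "continuous_on ({0..1} \<times> realization (order_complex W)) H"
    and Him: "H \<in> {0..1} \<times> realization (order_complex W) \<rightarrow> R"
    using H by (simp_all add: image_subset_iff_funcset)
  have HR: "H (t, q) \<in> R" if "0 \<le> t" "t \<le> 1" "q \<in> realization (order_complex W)" for t q
    by (rule funcset_mem[OF Him]) (use that in simp)
  have finW: "finite W" using U W by simp
  let ?D = "realization (order_complex U)"
  let ?S = "realization (order_complex {s \<in> U. \<tau> \<subseteq> s})"
  \<comment> \<open>\<open>P0\<close> is the part without the apex, \<open>P1\<close> and
    \<open>P2\<close> the lower and upper half of the cone. The projection \<open>r\<close> from the
    apex to the base divides by at least 1 / 2 on \<open>P1\<close>.\<close>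
  define P0 where "P0 = realization (order_complex (U - {\<tau>}))"
  define P1 where "P1 = ?S \<inter> {q. q \<tau> \<le> 1 / 2}"
  define P2 where "P2 = ?D \<inter> {q. 1 / 2 \<le> q \<tau>}"
  define r :: "('v set \<Rightarrow> real) \<Rightarrow> 'v set \<Rightarrow> real" where "r = (\<lambda>q s. if s = \<tau> then 0 else q s / (1 - q \<tau>))"
  have co: "continuous_on UNIV (\<lambda>q :: 'v set \<Rightarrow> real. q \<tau>)" by simp
  have clD: "closed ?D" "closed ?S" "closed P0"
    unfolding P0_def by (intro closed_realization finite_complex_order_complex; use U in simp)+
  have cl: "closed P0" "closed P1" "closed P2"
    unfolding P1_def P2_def
    by (intro clD closed_Int closed_Collect_le co continuous_on_const)+
  have SD: "?S \<subseteq> ?D" by (intro realization_mono order_complex_mono) auto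
  have P0D: "P0 \<subseteq> ?D" unfolding P0_def by (intro realization_mono order_complex_mono) auto
  have P0\<tau>: "q \<tau> = 0" if "q \<in> P0" for q
    using that by (auto simp: P0_def realization_def order_complex_def)
  have in_P0: "q \<in> P0" if "q \<in> ?D" "q \<tau> = 0" for q
    unfolding P0_def by (rule realization_order_complex_restrict[OF that(1)])
      (use that in \<open>auto simp: realization_def order_complex_def\<close>)
  have in_W: "q \<in> realization (order_complex W)" if "q \<in> ?S" "q \<tau> = 0" for q
    by (rule realization_order_complex_restrict[OF that(1)])
      (use that in \<open>auto simp: realization_def order_complex_def W\<close>)
  have in_S: "q \<in> ?S" if q: "q \<in> ?D" and "q \<tau> \<noteq> 0" for q
  proof (rule realization_order_complex_restrict[OF q])
    have ch: "{s. q s \<noteq> 0} \<subseteq> U" "\<And>s t. q s \<noteq> 0 \<Longrightarrow> q t \<noteq> 0 \<Longrightarrow> s \<subseteq> t \<or> t \<subseteq> s"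
      using q by (auto simp: realization_def order_complex_def)
    show "{s. q s \<noteq> 0} \<subseteq> {s \<in> U. \<tau> \<subseteq> s}"
    proof
      fix s assume "s \<in> {s. q s \<noteq> 0}"
      then have s: "s \<in> U" "s \<subseteq> \<tau> \<or> \<tau> \<subseteq> s" using ch(1) ch(2)[of s \<tau>] \<open>q \<tau> \<noteq> 0\<close> by auto
      then show "s \<in> {s \<in> U. \<tau> \<subseteq> s}" using min[OF s(1)] by auto
    qed
  qed
  have eqA: "P0 \<union> P1 = ?D \<inter> {q. q \<tau> \<le> 1 / 2}"
  proof (intro equalityI subsetI)
    fix x assume "x \<in> P0 \<union> P1"
    then show "x \<in> ?D \<inter> {q. q \<tau> \<le> 1 / 2}"
      using P0D SD P0\<tau>[of x] by (cases "x \<in> P0") (auto simp: P1_def)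
  next
    fix x assume "x \<in> ?D \<inter> {q. q \<tau> \<le> 1 / 2}"
    then show "x \<in> P0 \<union> P1"
      using in_P0[of x] in_S[of x] by (cases "x \<tau> = 0") (auto simp: P1_def)
  qed
  have eqD: "(P0 \<union> P1) \<union> P2 = ?D" unfolding eqA P2_def by (intro equalityI subsetI) auto
  have rW: "r q \<in> realization (order_complex W)" if q: "q \<in> P1" for q
  proof -
    have fS: "finite {s \<in> U. \<tau> \<subseteq> s}" using U by simp
    have qS: "q \<in> ?S" and q\<tau>: "q \<tau> \<le> 1 / 2" using q by (auto simp: P1_def)
    have q: "\<forall>s. 0 \<le> q s" "{s. q s \<noteq> 0} \<in> order_complex {s \<in> U. \<tau> \<subseteq> s}" "(\<Sum>s\<in>{s \<in> U. \<tau> \<subseteq> s}. q s) = 1"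
      using qS realization_order_complex_iff[OF fS, of q] by blast+
    have "{s \<in> U. \<tau> \<subseteq> s} = insert \<tau> W" "\<tau> \<notin> W" using \<tau> W by auto
    then have sum: "q \<tau> + (\<Sum>s\<in>W. q s) = 1" using q(3) finW by simp
    have supp: "{s. r q s \<noteq> 0} \<subseteq> {s. q s \<noteq> 0}" "r q \<tau> = 0" by (auto simp: r_def)
    have qc: "{s. q s \<noteq> 0} \<subseteq> {s \<in> U. \<tau> \<subseteq> s}" "\<And>s t. q s \<noteq> 0 \<Longrightarrow> q t \<noteq> 0 \<Longrightarrow> s \<subseteq> t \<or> t \<subseteq> s"
      using q(2) by (simp_all add: order_complex_def)
    have rq: "q s \<noteq> 0 \<and> s \<noteq> \<tau>" if "r q s \<noteq> 0" for s using supp that by blast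
    have "{s. r q s \<noteq> 0} \<subseteq> W" using rq qc(1) unfolding W by blast
    moreover have "s \<subseteq> t \<or> t \<subseteq> s" if "r q s \<noteq> 0" "r q t \<noteq> 0" for s t
      using qc(2)[of s t] rq that by simp
    ultimately have "{s. r q s \<noteq> 0} \<in> order_complex W" by (simp add: order_complex_def)
    moreover have "\<forall>s. 0 \<le> r q s" using q q\<tau> by (auto simp: r_def)
    moreover have "(\<Sum>s\<in>W. r q s) = 1"
    proof -
      have "(\<Sum>s\<in>W. r q s) = (\<Sum>s\<in>W. q s / (1 - q \<tau>))"
        by (rule sum.cong) (use \<open>\<tau> \<notin> W\<close> in \<open>auto simp: r_def\<close>)
      also have "\<dots> = (\<Sum>s\<in>W. q s) / (1 - q \<tau>)" by (simp add: sum_divide_distrib)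
      also have "\<dots> = 1" using sum q\<tau> by (simp add: field_simps)
      finally show ?thesis .
    qed
    ultimately show ?thesis using realization_order_complex_iff[OF finW, of "r q"] by blast
  qed
  have r0: "r q = q" if "q \<tau> = 0" for q using that by (auto simp: r_def fun_eq_iff)
  \<comment> \<open>The time \<open>2 * q \<tau>\<close> is 0 on the base, where \<open>r\<close> is
    the identity and \<open>H\<close> starts with \<open>h'\<close>, and 1 at the middle level,
    where the constant \<open>c\<close> takes over.\<close>
  define g where "g = (\<lambda>q. if q \<tau> = 0 then h' q else H (2 * q \<tau>, r q))"
  define h where "h = (\<lambda>q. if q \<tau> \<le> 1 / 2 then g q else c)"
  have coP: "continuous_on P (\<lambda>q :: 'v set \<Rightarrow> real. q s)" for P s
    by (rule continuous_on_subset[OF continuous_on_product_coordinates]) auto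
  have nn: "0 \<le> q \<tau>" if "q \<in> ?D" for q using that by (simp add: realization_def)
  have contH: "continuous_on P1 (\<lambda>q. H (2 * q \<tau>, r q))"
  proof (rule continuous_on_compose2[OF Hc])
    have "continuous_on P1 r" unfolding r_def
    proof (rule continuous_on_coordinatewise_then_product)
      fix s
      show "continuous_on P1 (\<lambda>q. if s = \<tau> then 0 else q s / (1 - q \<tau>))"
        by (cases "s = \<tau>") (auto intro!: continuous_intros coP simp: P1_def)
    qed
    then show "continuous_on P1 (\<lambda>q. (2 * q \<tau>, r q))"
      by (intro continuous_on_Pair continuous_on_mult continuous_on_const coP)
    show "(\<lambda>q. (2 * q \<tau>, r q)) ` P1 \<subseteq> {0..1} \<times> realization (order_complex W)"
    proof (rule image_subsetI)
      fix q assume q: "q \<in> P1"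
      then have "q \<in> ?D" "q \<tau> \<le> 1 / 2" using SD by (auto simp: P1_def)
      then show "(2 * q \<tau>, r q) \<in> {0..1} \<times> realization (order_complex W)" using nn rW[OF q] by simp
    qed
  qed
  have "continuous_on (P0 \<union> P1) g" unfolding g_def
  proof (rule continuous_on_cases_local)
    show "closedin (top_of_set (P0 \<union> P1)) P0" "closedin (top_of_set (P0 \<union> P1)) P1"
      by (intro closed_subset cl; simp)+
    show "continuous_on P0 h'" unfolding P0_def by (rule h')
    show "h' x = H (2 * x \<tau>, r x)" if "x \<in> P0 \<and> x \<tau> \<noteq> 0 \<or> x \<in> P1 \<and> x \<tau> = 0" for x
    proof -
      have "x \<tau> = 0" using that P0\<tau> by blast
      then show ?thesis using H0 r0 by simp
    qed
  qed (rule contH)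
  then have "continuous_on ((P0 \<union> P1) \<union> P2) h" unfolding h_def
  proof (rule continuous_on_cases_local[rotated 2])
    show "closedin (top_of_set (P0 \<union> P1 \<union> P2)) (P0 \<union> P1)" "closedin (top_of_set (P0 \<union> P1 \<union> P2)) P2"
      by (intro closed_subset closed_Un cl; auto)+
    show "g x = c" if "x \<in> P0 \<union> P1 \<and> \<not> x \<tau> \<le> 1 / 2 \<or> x \<in> P2 \<and> x \<tau> \<le> 1 / 2" for x
    proof -
      have "x \<tau> = 1 / 2"
        using that P0\<tau>[of x] by (auto simp: P1_def P2_def)
      then have "x \<tau> \<noteq> 0" "2 * x \<tau> = 1" by simp_all
      then show ?thesis unfolding g_def by (simp only: H1 if_False)
    qed
  qed (rule continuous_on_const)
  then have "continuous_on ?D h" unfolding eqD .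
  moreover have "h q = h' q" if "q \<in> realization (order_complex (U - {\<tau>}))" for q
    using P0\<tau>[of q] that by (simp add: h_def g_def P0_def)
  moreover have "h q \<in> R" if q: "q \<in> ?S" for q
  proof (cases "q \<tau> \<le> 1 / 2")
    case True
    have qW: "q \<in> realization (order_complex W)" if "q \<tau> = 0" by (rule in_W[OF q that])
    have "q \<in> P1" using q True by (simp add: P1_def)
    have "g q \<in> R"
    proof (cases "q \<tau> = 0")
      case True
      then show ?thesis using HR[OF _ _ qW, of 0] H0 by (simp add: g_def)
    next
      case False
      have "0 \<le> q \<tau>" using nn q SD by blast
      then show ?thesis using False True HR[OF _ _ rW[OF \<open>q \<in> P1\<close>], of "2 * q \<tau>"] by (simp add: g_def)
    qed
    then show ?thesis using True by (simp add: h_def)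
  qed (use c in \<open>simp add: h_def\<close>)
  ultimately show thesis by (intro that[of h] ballI)
qed

text \<open>
  The order complex above \<open>\<tau>\<close> has dimension below \<open>n - card \<tau>\<close>, and the common link of \<open>insert a \<tau>\<close>
  is still coned for \<open>2 * (n - card \<tau>)\<close> vertices because \<open>\<tau>\<close> is nonempty.
\<close>
lemma carrier_map:
  fixes K :: "'v set set"
  assumes K: "finite_complex K" "{} \<in> K" "coned (2 * n) K" and a: "{a} \<in> K"
    and IH: "\<And>l (L :: 'v set set). l < n \<Longrightarrow> finite_complex L \<Longrightarrow> {} \<in> L \<Longrightarrow> coned (2 * l) L \<Longrightarrow>
        \<exists>c\<in>realization L. homotopic_with_canon (\<lambda>_. True) (realization {F \<in> L. card F \<le> l}) (realization L) (\<lambda>x. x) (\<lambda>_. c)"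
    and N: "N = {F \<in> K. F \<noteq> {} \<and> card F \<le> n}"
  shows "U \<subseteq> N \<Longrightarrow> (\<And>s t. s \<in> U \<Longrightarrow> t \<in> N \<Longrightarrow> s \<subseteq> t \<Longrightarrow> t \<in> U) \<Longrightarrow>
    \<exists>h. continuous_on (realization (order_complex U)) h \<and>
      (\<forall>\<tau>\<in>U. \<forall>q\<in>realization (order_complex {s \<in> U. \<tau> \<subseteq> s}). h q \<in> realization (common_link K (insert a \<tau>)))"
proof (induction "card U" arbitrary: U)
  case 0
  have "finite U" using finite_subset[OF 0(2)] finite_complexD(1)[OF K(1)] N by simp
  then have "U = {}" using 0 by simp
  then have "realization (order_complex U) = {}" by (auto simp: realization_order_complex_iff)
  then show ?case using \<open>U = {}\<close> by simp
next
  case (Suc m)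
  note KD = finite_complexD[OF K(1)]
  have finU: "finite U" using finite_subset[OF Suc(3)] KD(1) N by simp
  have "U \<noteq> {}" using Suc(2) by auto
  \<comment> \<open>Removing a minimal member keeps the family closed under larger members of
    \<open>N\<close> and does not change the star above any other member.\<close>
  then obtain \<tau> where \<tau>: "\<tau> \<in> U" and min: "\<And>s. s \<in> U \<Longrightarrow> s \<subseteq> \<tau> \<Longrightarrow> s = \<tau>"
    using finite_has_minimal[OF finU] by metis
  define W where "W = {s \<in> U. \<tau> \<subset> s}"
  define L where "L = common_link K (insert a \<tau>)"
  define l where "l = n - card \<tau>"
  have \<tau>K: "\<tau> \<in> K" "\<tau> \<noteq> {}" "card \<tau> \<le> n" using \<tau> Suc(3) N by auto
  have fin\<tau>: "finite \<tau>" using KD(3) \<tau>K by blast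
  then have c\<tau>: "card \<tau> > 0" using \<tau>K by (simp add: card_gt_0_iff)
  have "\<exists>h. continuous_on (realization (order_complex (U - {\<tau>}))) h \<and>
      (\<forall>t\<in>U - {\<tau>}. \<forall>q\<in>realization (order_complex {s \<in> U - {\<tau>}. t \<subseteq> s}). h q \<in> realization (common_link K (insert a t)))"
  proof (rule Suc(1))
    show "m = card (U - {\<tau>})" using Suc(2) \<tau> finU by simp
    show "U - {\<tau>} \<subseteq> N" using Suc(3) by auto
    show "t \<in> U - {\<tau>}" if "s \<in> U - {\<tau>}" "t \<in> N" "s \<subseteq> t" for s t
      using that Suc(4)[of s t] min[of s] by auto
  qed
  then obtain h' where h': "continuous_on (realization (order_complex (U - {\<tau>}))) h'"
    "\<And>t q. t \<in> U - {\<tau>} \<Longrightarrow> q \<in> realization (order_complex {s \<in> U - {\<tau>}. t \<subseteq> s}) \<Longrightarrow> h' q \<in> realization (common_link K (insert a t))"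
    by blast
  have WU: "W \<subseteq> U - {\<tau>}" by (auto simp: W_def)
  have finW: "finite W" using finU by (simp add: W_def)
  \<comment> \<open>The carrier of a point is given by its least set \<open>t\<close>, which lies
    strictly above \<open>\<tau>\<close>; common links shrink as the set grows, so all these
    carriers lie in \<open>L\<close>.\<close>
  have h'W: "h' q \<in> realization L" if q: "q \<in> realization (order_complex W)" for q
  proof -
    obtain t where t: "t \<in> W" "q \<in> realization (order_complex {s \<in> W. t \<subseteq> s})"
      using realization_order_complex_least[OF finW q] by blast
    have "q \<in> realization (order_complex {s \<in> U - {\<tau>}. t \<subseteq> s})"
      using t(2) by (rule subsetD[OF realization_mono[OF order_complex_mono], rotated]) (use WU in auto)
    then have "h' q \<in> realization (common_link K (insert a t))"
      using h'(2) t(1) WU by blast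
    moreover have "common_link K (insert a t) \<subseteq> L" unfolding L_def
      by (rule common_link_antimono) (use t(1) in \<open>auto simp: W_def\<close>)
    ultimately show ?thesis using realization_mono by blast
  qed
  have contW: "continuous_on (realization (order_complex W)) h'"
    by (rule continuous_on_subset[OF h'(1) realization_mono[OF order_complex_mono[OF WU]]])
  have L: "finite_complex L" "{} \<in> L" unfolding L_def
    by (intro finite_complex_common_link K empty_in_common_link)+
  have "card (insert a \<tau>) \<le> Suc (card \<tau>)" by (rule card_insert_le_m1) auto
  then have Lc: "coned (2 * l) L" unfolding L_def
    using c\<tau> \<tau>K(3) fin\<tau> by (intro coned_common_link[OF K(1,3)]) (auto simp: l_def)
  have E: "extends_to_boundary TYPE('v) l (realization (order_complex W))"
  proof (rule realization_extends_to_boundary[OF finite_complex_order_complex[OF finW]])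
    fix C assume C: "C \<in> order_complex W"
    show "card C \<le> l" unfolding l_def
    proof (rule card_chain_above[OF C])
      fix s assume "s \<in> W"
      then have s: "s \<in> N" "\<tau> \<subset> s" using Suc(3) by (auto simp: W_def)
      then have "finite s" using KD(3) N by blast
      then show "finite s \<and> card \<tau> < card s \<and> card s \<le> n"
        using s N psubset_card_mono by auto
    qed
  qed
  have im: "h' ` realization (order_complex W) \<subseteq> realization L" using h'W by blast
  \<comment> \<open>The induction hypothesis contracts only a skeleton of \<open>L\<close>; the
    dimension bound allows \<open>h'\<close> to be pushed into it first.\<close>
  obtain g where g: "continuous_on (realization (order_complex W)) g"
      "g ` realization (order_complex W) \<subseteq> realization {F \<in> L. card F \<le> l}"
      "homotopic_with_canon (\<lambda>_. True) (realization (order_complex W)) (realization L) h' g"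
    using cellular_approximation[OF E L(1) contW im] by (elim exE conjE) (rule that; assumption)
  have "l < n" using c\<tau> \<tau>K(3) by (simp add: l_def)
  then obtain c where c: "c \<in> realization L"
      "homotopic_with_canon (\<lambda>_. True) (realization {F \<in> L. card F \<le> l}) (realization L) (\<lambda>x. x) (\<lambda>_. c)"
    using IH[OF _ L Lc] by blast
  have "homotopic_with_canon (\<lambda>_. True) (realization (order_complex W)) (realization L) ((\<lambda>x. x) \<circ> g) ((\<lambda>_. c) \<circ> g)"
    by (rule homotopic_with_compose_continuous_right[OF c(2) g(1)]) (use g(2) in auto)
  then have "homotopic_with_canon (\<lambda>_. True) (realization (order_complex W)) (realization L) g (\<lambda>_. c)"
    by (simp add: o_def)
  then have hom: "homotopic_with_canon (\<lambda>_. True) (realization (order_complex W)) (realization L) h' (\<lambda>_. c)"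
    by (rule homotopic_with_trans[OF g(3)])
  obtain h where h: "continuous_on (realization (order_complex U)) h"
    "\<forall>q\<in>realization (order_complex (U - {\<tau>})). h q = h' q"
    "\<forall>q\<in>realization (order_complex {s \<in> U. \<tau> \<subseteq> s}). h q \<in> realization L"
  proof (rule continuous_on_extend_cone[OF finU \<tau> _ W_def h'(1) hom c(1)])
    show "s = \<tau>" if "s \<in> U" "s \<subseteq> \<tau>" for s using that by (rule min)
  qed (rule that; assumption)
  have "h q \<in> realization (common_link K (insert a t))"
    if t: "t \<in> U" and q: "q \<in> realization (order_complex {s \<in> U. t \<subseteq> s})" for t q
  proof (cases "t = \<tau>")
    case True
    then show ?thesis using h(3) q by (simp add: L_def)
  next
    case False
    then have eq: "{s \<in> U. t \<subseteq> s} = {s \<in> U - {\<tau>}. t \<subseteq> s}" using min[OF t] by auto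
    have "q \<in> realization (order_complex (U - {\<tau>}))"
      using q unfolding eq by (rule subsetD[OF realization_mono[OF order_complex_mono], rotated]) auto
    then show ?thesis using h(2) h'(2)[of t q] q t False unfolding eq by simp
  qed
  then show ?case using h(1) by blast
qed

text \<open>The complex must vary in the induction, since the hypothesis is applied to common links.
  There is no separate base case: for n = 0 the skeleton has no points, and coning the empty set
  supplies the vertex \<open>a\<close>.\<close>

theorem skeleton_nullhomotopic:
  fixes K :: "'v set set"
  shows "finite_complex K \<Longrightarrow> {} \<in> K \<Longrightarrow> coned (2 * n) K \<Longrightarrow>
    \<exists>c\<in>realization K. homotopic_with_canon (\<lambda>_. True) (realization {F \<in> K. card F \<le> n}) (realization K) (\<lambda>x. x) (\<lambda>_. c)"
proof (induction n arbitrary: K rule: less_induct)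
  case (less n)
  note K = less.prems and KD = finite_complexD[OF less.prems(1)]
  obtain a where "\<forall>F\<in>K. F \<subseteq> {} \<longrightarrow> insert a F \<in> K"
    using K(3) unfolding coned_def by (metis card.empty finite.emptyI le0)
  then have a: "{a} \<in> K" using K(2) by auto
  define N where "N = {F \<in> K. F \<noteq> {} \<and> card F \<le> n}"
  define V where "V = \<Union>K"
  define Y where "Y = realization {F \<in> K. card F \<le> n}"
  have finV: "finite V" using KD(2) by (simp add: V_def)
  have finN: "finite N" using KD(1) by (simp add: N_def)
  have "a \<in> V" using a by (auto simp: V_def)
  then have cV: "card V > 0" using finV by (auto simp: card_gt_0_iff)
  obtain h where h: "continuous_on (realization (order_complex N)) h"
    "\<And>\<tau> q. \<tau> \<in> N \<Longrightarrow> q \<in> realization (order_complex {s \<in> N. \<tau> \<subseteq> s}) \<Longrightarrow> h q \<in> realization (common_link K (insert a \<tau>))"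
    using carrier_map[OF K a less.IH N_def, of N] by blast
  \<comment> \<open>Points \<open>x\<close> are moved to \<open>\<alpha> x\<close>, supported where \<open>x > m\<close>, and to \<open>\<beta> x\<close>, supported on superlevel
      sets of \<open>x\<close> at levels below \<open>m\<close>; so the support of \<open>\<alpha> x\<close> lies in every set occurring in \<open>\<beta> x\<close>.\<close>
  define m :: real where "m = 1 / (2 * real (card V))"
  have m: "m > 0" using cV by (simp add: m_def)
  define \<alpha>0 where "\<alpha>0 = (\<lambda>x :: 'v \<Rightarrow> real. \<Sum>v\<in>V. max 0 (x v - m))"
  define \<alpha> where "\<alpha> = (\<lambda>(x :: 'v \<Rightarrow> real) v. if v \<in> V then max 0 (x v - m) / \<alpha>0 x else 0)"
  \<comment> \<open>Nonzero for \<open>\<tau>\<close> in \<open>N\<close> only if \<open>x\<close>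
    is nonzero on \<open>\<tau>\<close>, strictly larger on \<open>\<tau>\<close> than off it, and
    less than \<open>m\<close> off it. Two sets with the middle property are nested, so the weights
    live on a chain.\<close>
  define w where "w = (\<lambda>(x :: 'v \<Rightarrow> real) \<tau>. (\<Prod>v\<in>\<tau>. x v) * (\<Prod>v\<in>\<tau>. \<Prod>u\<in>V - \<tau>. max 0 (x v - x u)) * (\<Prod>u\<in>V - \<tau>. max 0 (m - x u)))"
  define \<beta>0 where "\<beta>0 = (\<lambda>x. \<Sum>\<tau>\<in>N. w x \<tau>)"
  define \<beta> where "\<beta> = (\<lambda>x \<tau>. if \<tau> \<in> N then w x \<tau> / \<beta>0 x else 0)"
  have Y: "\<forall>v. 0 \<le> x v" "{v. x v \<noteq> 0} \<in> N" "{v. x v \<noteq> 0} \<subseteq> V" "(\<Sum>v\<in>V. x v) = 1" if "x \<in> Y" for x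
  proof -
    have "Y \<subseteq> realization K" unfolding Y_def by (rule realization_mono) auto
    then have xK: "x \<in> realization K" using that by blast
    show "\<forall>v. 0 \<le> x v" and s: "(\<Sum>v\<in>V. x v) = 1"
      using xK realization_iff[OF K(1), of x] unfolding V_def by blast+
    have k: "{v. x v \<noteq> 0} \<in> {F \<in> K. card F \<le> n}" using that unfolding Y_def realization_def by blast
    moreover have "{v. x v \<noteq> 0} \<noteq> {}"
    proof
      assume "{v. x v \<noteq> 0} = {}"
      then have "x v = 0" for v by blast
      then show False using s by simp
    qed
    ultimately show "{v. x v \<noteq> 0} \<in> N" by (simp add: N_def)
    show "{v. x v \<noteq> 0} \<subseteq> V" using k by (auto simp: V_def)
  qed
  have \<alpha>0: "\<alpha>0 x > 0" if x: "x \<in> Y" for x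
  proof -
    have "\<exists>v\<in>V. m < x v"
    proof (rule ccontr)
      assume "\<not> (\<exists>v\<in>V. m < x v)"
      then have "(\<Sum>v\<in>V. x v) \<le> (\<Sum>v\<in>V. m)" by (intro sum_mono) (auto simp: not_less)
      also have "\<dots> = 1 / 2" using cV by (simp add: m_def)
      finally show False using Y(4)[OF x] by simp
    qed
    then obtain v where "v \<in> V" "m < x v" by blast
    then show ?thesis unfolding \<alpha>0_def by (intro sum_pos2[OF finV, of v]) auto
  qed
  have \<alpha>K: "\<alpha> x \<in> realization K" and \<alpha>s: "{v. \<alpha> x v \<noteq> 0} \<subseteq> {v. x v \<noteq> 0}"
    and \<alpha>m: "\<And>v. \<alpha> x v \<noteq> 0 \<Longrightarrow> v \<in> V \<and> m < x v" if x: "x \<in> Y" for x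
  proof -
    show \<alpha>m: "v \<in> V \<and> m < x v" if "\<alpha> x v \<noteq> 0" for v
      using that by (auto simp: \<alpha>_def max_def split: if_splits)
    then show s: "{v. \<alpha> x v \<noteq> 0} \<subseteq> {v. x v \<noteq> 0}" using m by force
    have "{v. \<alpha> x v \<noteq> 0} \<in> K"
      by (rule KD(4)[OF _ s]) (use Y(2)[OF x] in \<open>simp add: N_def\<close>)
    moreover have "\<forall>v. 0 \<le> \<alpha> x v" using \<alpha>0[OF x] by (simp add: \<alpha>_def)
    moreover have "(\<Sum>v\<in>V. \<alpha> x v) = 1"
      using \<alpha>0[OF x] by (simp add: \<alpha>_def flip: sum_divide_distrib) (simp add: \<alpha>0_def)
    ultimately show "\<alpha> x \<in> realization K" using realization_iff[OF K(1), of "\<alpha> x"] by (simp add: V_def)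
  qed
  have finF: "finite \<tau>" "\<tau> \<subseteq> V" if "\<tau> \<in> N" for \<tau> using that KD(3) by (auto simp: N_def V_def)
  have w0: "0 \<le> w x \<tau>" if "x \<in> Y" for x \<tau>
    unfolding w_def using Y(1)[OF that] by (intro mult_nonneg_nonneg prod_nonneg) auto
  have wD: "(\<forall>v\<in>\<tau>. \<forall>u\<in>V - \<tau>. x u < x v) \<and> (\<forall>u\<in>V - \<tau>. x u < m)"
    if "w x \<tau> \<noteq> 0" "\<tau> \<in> N" for x \<tau>
  proof -
    have "(\<Prod>v\<in>\<tau>. \<Prod>u\<in>V - \<tau>. max 0 (x v - x u)) \<noteq> 0" "(\<Prod>u\<in>V - \<tau>. max 0 (m - x u)) \<noteq> 0"
      using that(1) by (auto simp: w_def)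
    then have "max 0 (x v - x u) \<noteq> 0 \<and> max 0 (m - x u) \<noteq> 0" if "v \<in> \<tau>" "u \<in> V - \<tau>" for v u
      using finF[OF \<open>\<tau> \<in> N\<close>] finV that by (simp add: prod_zero_iff)
    moreover have "max 0 (m - x u) \<noteq> 0" if "u \<in> V - \<tau>" for u
      using \<open>(\<Prod>u\<in>V - \<tau>. max 0 (m - x u)) \<noteq> 0\<close> finV that by (simp add: prod_zero_iff)
    moreover have "b < c" if "max 0 (c - b) \<noteq> 0" for b c :: real
      using that by (simp add: max_def split: if_splits)
    ultimately show ?thesis by blast
  qed
  \<comment> \<open>The full support of \<open>x\<close> always has positive weight: off it
    \<open>x\<close> is 0, which is less than \<open>m\<close>.\<close>
  have \<beta>0: "\<beta>0 x > 0" if x: "x \<in> Y" for x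
    unfolding \<beta>0_def
  proof (rule sum_pos2[OF finN Y(2)[OF x]])
    have nn: "0 < x v" if "x v \<noteq> 0" for v using Y(1)[OF x] that by (metis order_le_less)
    show "0 < w x {v. x v \<noteq> 0}"
      unfolding w_def using nn m by (intro mult_pos_pos prod_pos ballI) auto
  qed (rule w0[OF x])
  have \<beta>N: "\<beta> x \<in> realization (order_complex N)" if x: "x \<in> Y" for x
    unfolding realization_order_complex_iff[OF finN]
  proof (intro conjI allI)
    show "0 \<le> \<beta> x s" for s using w0[OF x] \<beta>0[OF x] by (simp add: \<beta>_def)
    show "(\<Sum>s\<in>N. \<beta> x s) = 1"
      using \<beta>0[OF x] by (simp add: \<beta>_def flip: sum_divide_distrib) (simp add: \<beta>0_def)
    have "s \<subseteq> t \<or> t \<subseteq> s" if "\<beta> x s \<noteq> 0" "\<beta> x t \<noteq> 0" for s t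
    proof (rule ccontr)
      have st: "s \<in> N" "t \<in> N" "w x s \<noteq> 0" "w x t \<noteq> 0"
        using that by (auto simp: \<beta>_def split: if_splits)
      assume "\<not> (s \<subseteq> t \<or> t \<subseteq> s)"
      then obtain v u where "v \<in> s" "v \<notin> t" "u \<in> t" "u \<notin> s" by blast
      moreover have "v \<in> V" "u \<in> V" using finF st calculation by blast+
      ultimately have "x u < x v" "x v < x u" using wD[OF st(3,1)] wD[OF st(4,2)] by blast+
      then show False by simp
    qed
    moreover have "{s. \<beta> x s \<noteq> 0} \<subseteq> N" by (auto simp: \<beta>_def split: if_splits)
    ultimately show "{s. \<beta> x s \<noteq> 0} \<in> order_complex N" by (simp add: order_complex_def)
  qed
  \<comment> \<open>One \<open>\<tau>\<close> serves both later homotopies: the support of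
    \<open>\<alpha> x\<close> and \<open>{a}\<close> are faces inside
    \<open>insert a \<tau>\<close>, so each of them spans a face with the support of
    \<open>h (\<beta> x)\<close>.\<close>
  have hb: "\<exists>\<tau>\<in>N. {v. \<alpha> x v \<noteq> 0} \<subseteq> \<tau> \<and> h (\<beta> x) \<in> realization (common_link K (insert a \<tau>))" if x: "x \<in> Y" for x
  proof -
    obtain \<tau> where \<tau>: "\<tau> \<in> N" "\<beta> x \<tau> \<noteq> 0" "\<beta> x \<in> realization (order_complex {s \<in> N. \<tau> \<subseteq> s})"
      using realization_order_complex_least[OF finN \<beta>N[OF x]] by blast
    have "w x \<tau> \<noteq> 0" using \<tau>(1,2) by (auto simp: \<beta>_def)
    then have "\<forall>u\<in>V - \<tau>. x u < m" using wD[OF _ \<tau>(1)] by blast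
    then have "v \<in> \<tau>" if "\<alpha> x v \<noteq> 0" for v using \<alpha>m[OF x that] by (metis DiffI less_asym)
    then have "{v. \<alpha> x v \<noteq> 0} \<subseteq> \<tau>" by blast
    then show ?thesis using \<tau>(1) h(2)[OF \<tau>(1,3)] by blast
  qed
  have \<alpha>0ne: "\<alpha>0 x \<noteq> 0" and \<beta>0ne: "\<beta>0 x \<noteq> 0" if "x \<in> Y" for x
    using \<alpha>0[OF that] \<beta>0[OF that] by simp_all
  have coY: "continuous_on Y (\<lambda>x :: 'v \<Rightarrow> real. x v)" for v
    by (rule continuous_on_subset[OF continuous_on_product_coordinates]) auto
  have c\<alpha>0: "continuous_on Y \<alpha>0" unfolding \<alpha>0_def by (intro continuous_intros coY)
  have c\<alpha>: "continuous_on Y \<alpha>" unfolding \<alpha>_def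
  proof (rule continuous_on_coordinatewise_then_product)
    show "continuous_on Y (\<lambda>x. if v \<in> V then max 0 (x v - m) / \<alpha>0 x else 0)" for v
      using \<alpha>0ne by (cases "v \<in> V") (auto intro!: continuous_intros coY c\<alpha>0)
  qed
  have cw: "continuous_on Y (\<lambda>x. w x \<tau>)" for \<tau> unfolding w_def by (intro continuous_intros coY)
  have c\<beta>0: "continuous_on Y \<beta>0" unfolding \<beta>0_def by (intro continuous_intros cw)
  have c\<beta>: "continuous_on Y \<beta>" unfolding \<beta>_def
  proof (rule continuous_on_coordinatewise_then_product)
    show "continuous_on Y (\<lambda>x. if \<tau> \<in> N then w x \<tau> / \<beta>0 x else 0)" for \<tau>
      using \<beta>0ne by (cases "\<tau> \<in> N") (auto intro!: continuous_intros cw c\<beta>0)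
  qed
  have chb: "continuous_on Y (\<lambda>x. h (\<beta> x))"
    by (rule continuous_on_compose2[OF h(1) c\<beta>]) (use \<beta>N in blast)
  have hK: "h (\<beta> x) \<in> realization K" if x: "x \<in> Y" for x
    using hb[OF x] realization_mono[OF common_link_subset] by blast
  define \<delta> where "\<delta> = (\<lambda>v. if v = a then 1 else 0 :: real)"
  have \<delta>s: "{v. \<delta> v \<noteq> 0} = {a}" by (auto simp: \<delta>_def)
  have \<delta>K: "\<delta> \<in> realization K" unfolding realization_def mem_Collect_eq \<delta>s using a by (simp add: \<delta>_def)
  have YK: "x \<in> realization K" if "x \<in> Y" for x
    using that realization_mono[of "{F \<in> K. card F \<le> n}" K] unfolding Y_def by blast
  have h1: "homotopic_with_canon (\<lambda>_. True) Y (realization K) (\<lambda>x. x) \<alpha>"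
  proof (rule linear_homotopy[OF K(1) continuous_on_id c\<alpha> YK \<alpha>K])
    fix x assume x: "x \<in> Y"
    have "{v. x v \<noteq> 0} \<union> {v. \<alpha> x v \<noteq> 0} = {v. x v \<noteq> 0}" using \<alpha>s[OF x] by blast
    then show "{v. x v \<noteq> 0} \<union> {v. \<alpha> x v \<noteq> 0} \<in> K" using Y(2)[OF x] by (simp add: N_def)
  qed
  have h2: "homotopic_with_canon (\<lambda>_. True) Y (realization K) \<alpha> (\<lambda>x. h (\<beta> x))"
  proof (rule linear_homotopy[OF K(1) c\<alpha> chb \<alpha>K hK])
    fix x assume x: "x \<in> Y"
    obtain \<tau> where \<tau>: "{v. \<alpha> x v \<noteq> 0} \<subseteq> \<tau>" "{v. h (\<beta> x) v \<noteq> 0} \<in> common_link K (insert a \<tau>)"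
      using hb[OF x] by (auto simp: realization_def)
    moreover have "{v. \<alpha> x v \<noteq> 0} \<in> K" using \<alpha>K[OF x] by (simp add: realization_def)
    ultimately have "{v. h (\<beta> x) v \<noteq> 0} \<union> {v. \<alpha> x v \<noteq> 0} \<in> K"
      unfolding common_link_def by blast
    then show "{v. \<alpha> x v \<noteq> 0} \<union> {v. h (\<beta> x) v \<noteq> 0} \<in> K" by (simp add: Un_commute)
  qed
  have h3: "homotopic_with_canon (\<lambda>_. True) Y (realization K) (\<lambda>x. h (\<beta> x)) (\<lambda>_. \<delta>)"
  proof (rule linear_homotopy[OF K(1) chb continuous_on_const hK \<delta>K])
    fix x assume x: "x \<in> Y"
    obtain \<tau> where "{v. h (\<beta> x) v \<noteq> 0} \<in> common_link K (insert a \<tau>)"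
      using hb[OF x] by (auto simp: realization_def)
    then show "{v. h (\<beta> x) v \<noteq> 0} \<union> {v. \<delta> v \<noteq> 0} \<in> K"
      unfolding common_link_def \<delta>s using a by blast
  qed
  have "homotopic_with_canon (\<lambda>_. True) Y (realization K) (\<lambda>x. x) (\<lambda>_. \<delta>)"
    by (rule homotopic_with_trans[OF homotopic_with_trans[OF h1 h2] h3])
  then show ?case using \<delta>K unfolding Y_def by blast
qed

theorem coned_imp_k_connected:
  fixes K :: "'v set set"
  assumes K: "finite_complex K" "{} \<in> K" "coned (2 * k + 2) K"
  shows "k_connected k (geometric_realization K)"
  unfolding k_connected_def
proof (intro allI impI)
  fix i f assume i: "i \<le> k" and f: "continuous_map (nsphere i) (geometric_realization K) f"
  have fc: "continuous_on (sphere_set i) f" "f ` sphere_set i \<subseteq> realization K"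
    using f unfolding nsphere_eq geometric_realization_eq by (simp_all add: image_subset_iff_funcset)
  \<comment> \<open>\<open>Suc k\<close> because the extension property bounds the dimension
    strictly; correspondingly, faces with at most \<open>Suc k\<close> vertices form the
    k-skeleton.\<close>
  have E: "extends_to_boundary TYPE('v) (Suc k) (sphere_set i)"
    by (rule extends_to_boundary_mono[OF sphere_extends_to_boundary]) (use i in simp)
  then obtain g where g: "continuous_on (sphere_set i) g"
      "g ` sphere_set i \<subseteq> realization {F \<in> K. card F \<le> Suc k}"
      "homotopic_with_canon (\<lambda>_. True) (sphere_set i) (realization K) f g"
    using cellular_approximation[OF E K(1) fc] by (elim exE conjE) (rule that; assumption)
  have "coned (2 * Suc k) K" using K(3) by simp
  then obtain c where
    c: "homotopic_with_canon (\<lambda>_. True) (realization {F \<in> K. card F \<le> Suc k}) (realization K) (\<lambda>x. x) (\<lambda>_. c)"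
    using skeleton_nullhomotopic[OF K(1,2)] by blast
  have "homotopic_with_canon (\<lambda>_. True) (sphere_set i) (realization K) ((\<lambda>x. x) \<circ> g) ((\<lambda>_. c) \<circ> g)"
    by (rule homotopic_with_compose_continuous_right[OF c g(1)]) (use g(2) in auto)
  then have "homotopic_with_canon (\<lambda>_. True) (sphere_set i) (realization K) g (\<lambda>_. c)"
    by (simp add: o_def)
  then have "homotopic_with_canon (\<lambda>_. True) (sphere_set i) (realization K) f (\<lambda>_. c)"
    by (rule homotopic_with_trans[OF g(3)])
  then show "\<exists>c. homotopic_with (\<lambda>_. True) (nsphere i) (geometric_realization K) f (\<lambda>_. c)"
    unfolding nsphere_eq geometric_realization_eq by blast
qed

section \<open>The random clique complex\<close>

text \<open>Only sets of \<open>d + 1\<close> vertices have to be tested. Those in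
  \<open>insert v F\<close> that contain \<open>v\<close> arise from a d-subset of \<open>S\<close>
  and are faces by the choice of \<open>v\<close>; the others lie in \<open>F\<close>.\<close>

lemma coned_clique_complex:
  assumes m: "m \<le> n"
    and X: "X = {F. F \<subseteq> {1..n} \<and> (card F \<le> d \<or> card F = d + 1 \<and> f F)}"
    and common: "\<And>S. S \<subseteq> {1..n} \<Longrightarrow> card S = m \<Longrightarrow>
        \<exists>v\<in>{1..n} - S. \<forall>T\<in>{T. T \<subseteq> S \<and> card T = d}. f (insert v T)"
  shows "coned m (clique_complex d {1..n} X)"
  unfolding coned_def
proof (intro allI impI, elim conjE)
  fix S :: "nat set" assume S: "finite S" "card S \<le> m"
  \<comment> \<open>\<open>coned\<close> allows smaller sets and vertices outside the range, while
    the event concerns sets of exactly \<open>m\<close> vertices, so \<open>S\<close> is trimmed and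
    then enlarged.\<close>
  have "card (S \<inter> {1..n}) \<le> m" using S card_mono[of S "S \<inter> {1..n}"] by auto
  then obtain S1 where S1: "S \<inter> {1..n} \<subseteq> S1" "S1 \<subseteq> {1..n}" "card S1 = m"
    using exists_subset_between[of "S \<inter> {1..n}" m "{1..n}"] m by auto
  obtain v where v: "v \<in> {1..n}" "v \<notin> S1" "\<And>T. T \<subseteq> S1 \<Longrightarrow> card T = d \<Longrightarrow> f (insert v T)"
    using common[OF S1(2,3)] by auto
  show "\<exists>v. \<forall>F\<in>clique_complex d {1..n} X. F \<subseteq> S \<longrightarrow> insert v F \<in> clique_complex d {1..n} X"
  proof (intro exI[of _ v] ballI impI)
    fix F assume F: "F \<in> clique_complex d {1..n} X" "F \<subseteq> S"
    then have Fn: "F \<subseteq> {1..n}" and FX: "\<And>T. T \<subseteq> F \<Longrightarrow> card T = d + 1 \<Longrightarrow> T \<in> X"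
      by (auto simp: clique_complex_def)
    have FS1: "F \<subseteq> S1" using Fn F(2) S1(1) by blast
    have "T \<in> X" if T: "T \<subseteq> insert v F" "card T = d + 1" for T
    proof (cases "v \<in> T")
      case True
      have "finite T" using T(2) by (metis Suc_eq_plus1 card.infinite nat.distinct(1))
      then have "card (T - {v}) = d" using True T(2) by simp
      moreover have "T - {v} \<subseteq> S1" using T(1) FS1 by blast
      ultimately have "f (insert v (T - {v}))" using v(3) by blast
      then have "f T" using True by (simp add: insert_absorb)
      moreover have "T \<subseteq> {1..n}" using T(1) v(1) Fn by blast
      ultimately show ?thesis using T(2) by (simp add: X)
    qed (use T FX in blast)
    then show "insert v F \<in> clique_complex d {1..n} X"
      using v(1) Fn by (auto simp: clique_complex_def)
  qed
qed

lemma finite_complex_clique_complex: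
  assumes "finite V"
  shows "finite_complex (clique_complex d V X)" "{} \<in> clique_complex d V X"
proof -
  have "clique_complex d V X \<subseteq> Pow V" by (auto simp: clique_complex_def)
  then have "finite (clique_complex d V X)" using assms by (simp add: finite_subset)
  then show "finite_complex (clique_complex d V X)"
    using assms finite_subset unfolding finite_complex_def clique_complex_def by auto
  show "{} \<in> clique_complex d V X" by (auto simp: clique_complex_def)
qed

section \<open>Independence and the union bound\<close>

lemma prob_pair_pmf_Times:
  "measure_pmf.prob (pair_pmf M N) (A \<times> B) = measure_pmf.prob M A * measure_pmf.prob N B"
proof -
  \<comment> \<open>Intersecting with the supports makes both factors countable, as the product rule
    requires.\<close>
  have "measure_pmf.prob (pair_pmf M N) (A \<times> B) = measure_pmf.prob (pair_pmf M N) ((A \<times> B) \<inter> set_pmf (pair_pmf M N))"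
    by (simp only: measure_Int_set_pmf)
  also have "(A \<times> B) \<inter> set_pmf (pair_pmf M N) = (A \<inter> set_pmf M) \<times> (B \<inter> set_pmf N)"
    by auto
  also have "measure_pmf.prob (pair_pmf M N) \<dots> = measure_pmf.prob M (A \<inter> set_pmf M) * measure_pmf.prob N (B \<inter> set_pmf N)"
    by (rule measure_pmf_prob_product) (auto intro: countable_subset[OF _ countable_set_pmf])
  finally show ?thesis by (simp only: measure_Int_set_pmf)
qed

text \<open>Disjoint blocks of coordinates are independent. One block is split off at a time, so the
  ground set \<open>A\<close> shrinks along the induction.\<close>

lemma prob_no_full_block:
  assumes p: "0 \<le> p" "p \<le> 1" and "finite I"
  shows "finite A \<Longrightarrow> (\<And>i. i \<in> I \<Longrightarrow> B i \<subseteq> A) \<Longrightarrow> disjoint_family_on B I \<Longrightarrow>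
    measure_pmf.prob (Pi_pmf A False (\<lambda>_. bernoulli_pmf p)) {f. \<forall>i\<in>I. \<exists>x\<in>B i. \<not> f x}
      = (\<Prod>i\<in>I. 1 - p ^ card (B i))"
  using \<open>finite I\<close>
proof (induction I arbitrary: A)
  case empty
  then show ?case by simp
next
  case (insert i I)
  let ?P = "\<lambda>A. Pi_pmf A False (\<lambda>_. bernoulli_pmf p)"
  have Bi: "B i \<subseteq> A" using insert.prems(2) by simp
  have finBi: "finite (B i)" by (rule finite_subset[OF Bi insert.prems(1)])
  have disj: "B i \<inter> B j = {}" if "j \<in> I" for j
    using insert.prems(3) insert.hyps(2) that by (auto simp: disjoint_family_on_def)
  have "?P A = ?P (B i \<union> (A - B i))" using Bi by (simp add: Un_absorb1)
  also have "\<dots> = map_pmf (\<lambda>(f, g) x. if x \<in> B i then f x else g x) (pair_pmf (?P (B i)) (?P (A - B i)))"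
    using finBi insert.prems(1) by (intro Pi_pmf_union) auto
  finally have "measure_pmf.prob (?P A) {f. \<forall>i\<in>insert i I. \<exists>x\<in>B i. \<not> f x}
     = measure_pmf.prob (pair_pmf (?P (B i)) (?P (A - B i)))
        ((\<lambda>(f, g) x. if x \<in> B i then f x else g x) -` {f. \<forall>i\<in>insert i I. \<exists>x\<in>B i. \<not> f x})"
    by simp
  also have "(\<lambda>(f, g) x. if x \<in> B i then f x else g x) -` {f. \<forall>i\<in>insert i I. \<exists>x\<in>B i. \<not> f x}
      = {f. \<exists>x\<in>B i. \<not> f x} \<times> {g. \<forall>j\<in>I. \<exists>x\<in>B j. \<not> g x}" (is "?L = ?R")
  proof -
    have iff: "(f, g) \<in> ?L \<longleftrightarrow> (f, g) \<in> ?R" for f g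
    proof -
      let ?h = "\<lambda>x. if x \<in> B i then f x else g x"
      have "(\<exists>x\<in>B i. \<not> ?h x) \<longleftrightarrow> (\<exists>x\<in>B i. \<not> f x)" by simp
      moreover have "(\<forall>j\<in>I. \<exists>x\<in>B j. \<not> ?h x) \<longleftrightarrow> (\<forall>j\<in>I. \<exists>x\<in>B j. \<not> g x)"
      proof (intro ball_cong bex_cong refl)
        show "(\<not> ?h x) = (\<not> g x)" if "j \<in> I" "x \<in> B j" for j x
        proof -
          have "x \<notin> B i" using disj[OF that(1)] that(2) by blast
          then show ?thesis by simp
        qed
      qed
      ultimately show ?thesis
        by (simp only: vimage_eq mem_Collect_eq case_prod_conv Set.ball_simps(7) mem_Times_iff fst_conv snd_conv)
    qed
    show ?thesis
    proof (intro equalityI subrelI)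
      show "(f, g) \<in> ?R" if "(f, g) \<in> ?L" for f g using that by (rule iffD1[OF iff])
      show "(f, g) \<in> ?L" if "(f, g) \<in> ?R" for f g using that by (rule iffD2[OF iff])
    qed
  qed
  also have "measure_pmf.prob (pair_pmf (?P (B i)) (?P (A - B i))) \<dots>
     = measure_pmf.prob (?P (B i)) {f. \<exists>x\<in>B i. \<not> f x} * measure_pmf.prob (?P (A - B i)) {g. \<forall>j\<in>I. \<exists>x\<in>B j. \<not> g x}"
    by (rule prob_pair_pmf_Times)
  also have "measure_pmf.prob (?P (A - B i)) {g. \<forall>j\<in>I. \<exists>x\<in>B j. \<not> g x} = (\<Prod>i\<in>I. 1 - p ^ card (B i))"
  proof (rule insert.IH)
    show "finite (A - B i)" using insert.prems by simp
    show "B j \<subseteq> A - B i" if "j \<in> I" for j using insert.prems(2)[of j] disj[OF that] that by auto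
    show "disjoint_family_on B I" using insert.prems(3) by (auto simp: disjoint_family_on_def)
  qed
  also have "measure_pmf.prob (?P (B i)) {f. \<exists>x\<in>B i. \<not> f x} = 1 - p ^ card (B i)"
  proof -
    have "measure_pmf.prob (?P (B i)) (Pi (B i) (\<lambda>_. {True})) = (\<Prod>x\<in>B i. measure_pmf.prob (bernoulli_pmf p) {True})"
      by (rule measure_Pi_pmf_Pi[OF finBi])
    also have "\<dots> = p ^ card (B i)" using p by (simp add: measure_pmf_single)
    finally have "measure_pmf.prob (?P (B i)) (Pi (B i) (\<lambda>_. {True})) = p ^ card (B i)" .
    moreover have "{f. \<exists>x\<in>B i. \<not> f x} = UNIV - Pi (B i) (\<lambda>_. {True})" by (auto simp: Pi_def)
    ultimately show ?thesis
      using measure_pmf.prob_compl[of "Pi (B i) (\<lambda>_. {True})" "?P (B i)"] by simp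
  qed
  finally show ?case using insert.hyps by simp
qed

text \<open>Distinct vertices outside \<open>S\<close> need disjoint sets of faces, because each
  such face contains exactly one vertex outside \<open>S\<close>. Their failures are therefore
  independent, and each vertex needs \<open>card S choose d\<close> faces.\<close>

lemma prob_no_common_vertex:
  assumes p: "0 \<le> p" "p \<le> 1" and S: "S \<subseteq> {1..n}"
  shows "measure_pmf.prob (Pi_pmf {F. F \<subseteq> {1..n} \<and> card F = d + 1} False (\<lambda>_. bernoulli_pmf p))
      {f. \<forall>v\<in>{1..n} - S. \<exists>T\<in>{T. T \<subseteq> S \<and> card T = d}. \<not> f (insert v T)}
    = (1 - p ^ (card S choose d)) ^ (n - card S)"
proof -
  define B where "B = (\<lambda>v. insert v ` {T. T \<subseteq> S \<and> card T = d})"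
  have finS: "finite S" using S finite_subset by blast
  have "measure_pmf.prob (Pi_pmf {F. F \<subseteq> {1..n} \<and> card F = d + 1} False (\<lambda>_. bernoulli_pmf p))
      {f. \<forall>v\<in>{1..n} - S. \<exists>x\<in>B v. \<not> f x} = (\<Prod>v\<in>{1..n} - S. 1 - p ^ card (B v))"
  proof (rule prob_no_full_block[OF p])
    show "finite {F. F \<subseteq> {1..n} \<and> card F = d + 1}" by simp
    show "B v \<subseteq> {F. F \<subseteq> {1..n} \<and> card F = d + 1}" if v: "v \<in> {1..n} - S" for v
    proof
      fix F assume "F \<in> B v"
      then obtain T where T: "T \<subseteq> S" "card T = d" "F = insert v T" by (auto simp: B_def)
      moreover have "finite T" "v \<notin> T" using T v finS finite_subset by auto
      ultimately show "F \<in> {F. F \<subseteq> {1..n} \<and> card F = d + 1}" using v S by auto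
    qed
    show "disjoint_family_on B ({1..n} - S)"
      unfolding disjoint_family_on_def B_def by blast
  qed simp
  also have "\<dots> = (\<Prod>v\<in>{1..n} - S. 1 - p ^ (card S choose d))"
  proof (rule prod.cong)
    fix v assume v: "v \<in> {1..n} - S"
    have "inj_on (insert v) {T. T \<subseteq> S \<and> card T = d}"
    proof (rule inj_onI)
      fix x y assume "x \<in> {T. T \<subseteq> S \<and> card T = d}" "y \<in> {T. T \<subseteq> S \<and> card T = d}"
        and eq: "insert v x = insert v y"
      then have "v \<notin> x" "v \<notin> y" using v by auto
      then show "x = y" using eq by (simp add: insert_ident)
    qed
    then have "card (B v) = card S choose d"
      unfolding B_def using n_subsets[OF finS] by (simp add: card_image)
    then show "1 - p ^ card (B v) = 1 - p ^ (card S choose d)" by simp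
  qed simp
  also have "\<dots> = (1 - p ^ (card S choose d)) ^ (n - card S)"
    using S finS by (simp add: card_Diff_subset)
  finally show ?thesis by (simp add: B_def)
qed

lemma prob_clique_complex_k_connected_ge:
  assumes p: "0 \<le> p" "p \<le> 1" and n: "2 * k + 2 \<le> n"
  shows "1 - real (n choose (2 * k + 2)) * (1 - p ^ ((2 * k + 2) choose d)) ^ (n - (2 * k + 2))
    \<le> measure_pmf.prob (random_complex d n p)
        {X. k_connected k (geometric_realization (clique_complex d {1..n} X))}"
proof -
  define m where "m = 2 * k + 2"
  let ?P = "Pi_pmf {F. F \<subseteq> {1..n} \<and> card F = d + 1} False (\<lambda>_. bernoulli_pmf p)"
  define X where "X = (\<lambda>f. {F. F \<subseteq> {1..n} \<and> (card F \<le> d \<or> card F = d + 1 \<and> f F)})"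
  define SS where "SS = {S. S \<subseteq> {1..n} \<and> card S = m}"
  define Bad where "Bad = (\<lambda>S. {f. \<forall>v\<in>{1..n} - S. \<exists>T\<in>{T. T \<subseteq> S \<and> card T = d}. \<not> f (insert v T)})"
  define Good where "Good = {X. k_connected k (geometric_realization (clique_complex d {1..n} X))}"
  have finSS: "finite SS" by (simp add: SS_def)
  have "X f \<in> Good" if f: "f \<notin> (\<Union>S\<in>SS. Bad S)" for f
  proof -
    have "coned m (clique_complex d {1..n} (X f))"
    proof (rule coned_clique_complex[where f = f])
      show "m \<le> n" using n by (simp add: m_def)
      show "\<exists>v\<in>{1..n} - S. \<forall>T\<in>{T. T \<subseteq> S \<and> card T = d}. f (insert v T)"
        if "S \<subseteq> {1..n}" "card S = m" for S
        using f that unfolding SS_def Bad_def by blast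
    qed (simp add: X_def)
    then have "k_connected k (geometric_realization (clique_complex d {1..n} (X f)))"
      unfolding m_def by (intro coned_imp_k_connected finite_complex_clique_complex finite_atLeastAtMost)
    then show ?thesis unfolding Good_def mem_Collect_eq .
  qed
  then have "UNIV - (\<Union>S\<in>SS. Bad S) \<subseteq> X -` Good" by blast
  then have "measure_pmf.prob ?P (UNIV - (\<Union>S\<in>SS. Bad S)) \<le> measure_pmf.prob ?P (X -` Good)"
    by (rule measure_pmf.finite_measure_mono) simp
  moreover have "measure_pmf.prob ?P (UNIV - (\<Union>S\<in>SS. Bad S)) = 1 - measure_pmf.prob ?P (\<Union>S\<in>SS. Bad S)"
    using measure_pmf.prob_compl[of "\<Union>S\<in>SS. Bad S" ?P] by simp
  moreover have "measure_pmf.prob ?P (\<Union>S\<in>SS. Bad S) \<le> (\<Sum>S\<in>SS. measure_pmf.prob ?P (Bad S))"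
    by (rule measure_pmf.finite_measure_subadditive_finite[OF finSS]) simp
  moreover have "(\<Sum>S\<in>SS. measure_pmf.prob ?P (Bad S)) = (\<Sum>S\<in>SS. (1 - p ^ (m choose d)) ^ (n - m))"
  proof (rule sum.cong[OF refl])
    fix S assume "S \<in> SS"
    then have S: "S \<subseteq> {1..n}" and c: "card S = m" by (simp_all add: SS_def)
    show "measure_pmf.prob ?P (Bad S) = (1 - p ^ (m choose d)) ^ (n - m)"
      using prob_no_common_vertex[OF p S, of d] unfolding c Bad_def .
  qed
  moreover have "card SS = n choose m" unfolding SS_def using n_subsets[of "{1..n}" m] by simp
  moreover have "measure_pmf.prob (random_complex d n p) Good = measure_pmf.prob ?P (X -` Good)"
    by (simp add: random_complex_def X_def)
  ultimately show ?thesis unfolding Good_def m_def by simp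
qed

section \<open>Asymptotics of the failure probability\<close>

lemma bernoulli_pmf_min: "bernoulli_pmf (min 1 p) = bernoulli_pmf p"
  by (rule pmf_eqI) (simp add: bernoulli_pmf.rep_eq max_def min_def)

text \<open>The binomial is at most \<open>exp (m * ln n)\<close>, which cancels the same term in
  the bound \<open>exp (- q * n)\<close>. Having the exponent \<open>n - m\<close> instead of
  \<open>n\<close> costs a factor \<open>exp (q * m)\<close>, at most \<open>exp m\<close> for
  \<open>q < 1\<close>; for \<open>q \<ge> 1\<close> the left side is 0 because
  \<open>m < n\<close>.\<close>

lemma union_bound_estimate:
  fixes n m :: nat and w :: real
  assumes n: "m < n" and q: "q = (real m * ln (real n) + w) / real n"
  shows "real (n choose m) * (1 - min 1 q) ^ (n - m) \<le> exp (real m - w)"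
proof (cases "1 \<le> q")
  case True
  then show ?thesis using n by (simp add: power_0_left)
next
  case False
  have n0: "real n > 0" using n by simp
  have "1 - q \<le> exp (- q)" using exp_ge_add_one_self[of "- q"] by simp
  then have "(1 - q) ^ (n - m) \<le> exp (- q) ^ (n - m)"
    using False by (intro power_mono) auto
  also have "\<dots> = exp (real (n - m) * (- q))" by (rule exp_of_nat_mult[symmetric])
  also have "real (n - m) * (- q) = - (q * real n) + q * real m"
    using n by (simp add: of_nat_diff algebra_simps)
  also have "exp \<dots> \<le> exp (- (real m * ln (real n) + w) + real m)"
  proof -
    have "q * real n = real m * ln (real n) + w" using n0 by (simp add: q)
    moreover have "q * real m \<le> 1 * real m" using False by (intro mult_right_mono) auto
    ultimately show ?thesis by simp
  qed
  finally have "(1 - q) ^ (n - m) \<le> exp (- (real m * ln (real n) + w) + real m)" .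
  moreover have "real (n choose m) \<le> exp (real m * ln (real n))"
  proof -
    have "real (n choose m) \<le> real (n ^ m)" using binomial_le_pow[of m n] n by (simp only: of_nat_le_iff)
    also have "\<dots> = exp (real m * ln (real n))" using n0 by (simp add: exp_of_nat_mult)
    finally show ?thesis .
  qed
  ultimately have "real (n choose m) * (1 - q) ^ (n - m)
      \<le> exp (real m * ln (real n)) * exp (- (real m * ln (real n) + w) + real m)"
    using False by (intro mult_mono) auto
  also have "\<dots> = exp (real m - w)" by (simp flip: exp_add)
  finally show ?thesis using False by (simp add: min_def)
qed

theorem theorem3p2:
  fixes d k :: nat and \<omega> p :: "nat \<Rightarrow> real"
  assumes "d \<ge> 1" and "2 * k + 2 \<ge> d"
    and "filterlim \<omega> at_top sequentially"
    and "\<And>n. p n = ((real (2 * k + 2) * ln (real n) + \<omega> n) / real n)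
                     powr (1 / real ((2 * k + 2) choose d))"
  shows "(\<lambda>n. measure_pmf.prob (random_complex d n (p n))
            {X. k_connected k (geometric_realization (clique_complex d {1..n} X))})
         \<longlonglongrightarrow> 1"
proof -
  define m where "m = 2 * k + 2"
  define C where "C = m choose d"
  define Q where "Q = (\<lambda>n. measure_pmf.prob (random_complex d n (p n))
            {X. k_connected k (geometric_realization (clique_complex d {1..n} X))})"
  have C: "C > 0" unfolding C_def m_def using assms(2) by simp
  \<comment> \<open>For large \<open>n\<close>, nonnegative \<open>\<omega> n\<close> and
    \<open>n > m\<close> make the base \<open>q\<close> positive, so that \<open>powr\<close> is a
    genuine root.\<close>
  have "eventually (\<lambda>n. 0 \<le> \<omega> n) sequentially"
    using assms(3) by (simp add: filterlim_at_top)
  then have lower: "eventually (\<lambda>n. 1 - exp (real m - \<omega> n) \<le> Q n) sequentially"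
    using eventually_gt_at_top[of m]
  proof eventually_elim
    case (elim n)
    define q where "q = (real m * ln (real n) + \<omega> n) / real n"
    have "n \<ge> 1" using elim by simp
    then have q0: "q > 0"
      unfolding q_def using elim m_def by (intro divide_pos_pos add_pos_nonneg mult_pos_pos) auto
    have pq: "p n = q powr (1 / real C)" unfolding assms(4) q_def C_def m_def ..
    \<comment> \<open>A fast growing \<open>\<omega>\<close> can push \<open>p n\<close> above 1;
      capping it leaves the random complex unchanged and makes the bound for probabilities
      applicable.\<close>
    define p' where "p' = min 1 (p n)"
    have p': "0 \<le> p'" "p' \<le> 1" by (auto simp: p'_def pq)
    have "p' ^ C = min 1 q"
    proof (cases "q \<ge> 1")
      case True
      then show ?thesis using C by (simp add: p'_def pq ge_one_powr_ge_zero)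
    next
      case False
      then have "q powr (1 / real C) \<le> 1" using q0 by (intro powr_le1) auto
      moreover have "(q powr (1 / real C)) ^ C = q"
        using q0 C by (simp add: powr_realpow[symmetric] powr_powr)
      ultimately show ?thesis using False by (simp add: p'_def pq min_def)
    qed
    moreover have "1 - real (n choose m) * (1 - p' ^ C) ^ (n - m) \<le> Q n"
    proof -
      have "random_complex d n p' = random_complex d n (p n)"
        by (simp add: random_complex_def p'_def bernoulli_pmf_min)
      then show ?thesis
        using prob_clique_complex_k_connected_ge[OF p', of k n d] elim
        by (simp add: Q_def m_def C_def)
    qed
    ultimately show ?case
      using union_bound_estimate[of m n q "\<omega> n"] elim q_def by simp
  qed
  have upper: "eventually (\<lambda>n. Q n \<le> 1) sequentially" by (simp add: Q_def)
  have "filterlim (\<lambda>n. real m - \<omega> n) at_bot sequentially"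
    using assms(3) filterlim_tendsto_add_at_top[OF tendsto_const[of "- real m"]]
    by (simp add: filterlim_uminus_at_bot)
  then have "(\<lambda>n. exp (real m - \<omega> n)) \<longlonglongrightarrow> 0"
    by (rule filterlim_compose[OF exp_at_bot])
  then have "(\<lambda>n. 1 - exp (real m - \<omega> n)) \<longlonglongrightarrow> 1 - 0" by (intro tendsto_intros)
  then have "(\<lambda>n. 1 - exp (real m - \<omega> n)) \<longlonglongrightarrow> 1" by simp
  from tendsto_sandwich[OF lower upper this tendsto_const] show ?thesis unfolding Q_def .
qed

end
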